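(* Let $L\in\{1,\infty\}$, let $\rho$ be a function quasi-norm on $(0,L)$, and let $B$ and $E$ be the corresponding quasi-Banach function space and rearrangement-invariant (r.i.) quasi-Banach function space, with $\|f\|_B=\rho(|f|)$ and $\|f\|_E=\rho(f^* )$. Let $p_E,q_E$ be the lower and upper Boyd indices of $E$. Let $d\in SV$, $0<U<\infty$, $0<V\le\infty$, $0<W\le\infty$. (i) If $0<U<p_E$, then for all $f\in\mathfrak M(0,L)$ $$\|f\|_E\sim\big\|H^{(U,W;d)}f\big\|_B .$$ Moreover, $\|H^{(U,W;d)}f\|_B$ is an equivalent quasi-norm on $E$, and $E$ equipped with this quasi-norm is also an r.i. quasi-Banach function space. (ii) If $q_E<V\le\infty$, then for all $f\in\mathfrak M(0,L)$ $$\|f\|_E\sim\big\|H_{(V,W;d)}f\big\|_B .$$ Moreover, $\|H_{(V,W;d)}f\|_B$ is an equivalent quasi-norm on $E$, and $E$ equipped with this quasi-norm is also an r.i. quasi-Banach function space.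
   Context: Conventions: $1/\infty=0$. $\mathfrak M(0,L)$ is the set of complex-valued Lebesgue measurable a.e. finite functions on $(0,L)$ (identified if equal a.e.), $\mathfrak M^+(0,L)$ its subset of non-negative functions. For $0<q\le\infty$, $\|\cdot\|_{q,(a,b)}$ is the usual Lebesgue (quasi-)norm on $(a,b)$ (essential supremum if $q=\infty$). $f^*(t)=\inf\{\lambda>0:\ |\{x\in(0,L):|f(x)|>\lambda\}|\le t\}$, $t>0$, is the non-increasing rearrangement. $F\sim G$ means $c\,G\le F\le C\,G$ with constants $0<c\le C<\infty$ independent of $f$ (both sides may be $\infty$). $SV$: positive measurable $d$ on $(0,L)$ such that for every $\varepsilon>0$ the function $t^{\varepsilon}d(t)$ is equivalent ($\sim$, pointwise with constants) to a non-decreasing function and $t^{-\varepsilon}d(t)$ is equivalent to a non-increasing function. Function quasi-norm: a map $\rho:\mathfrak M^+(0,L)\to[0,\infty]$ for which there is $C_\rho\ge1$ such that for $f,g,f_n\in\mathfrak M^+(0,L)$, $\lambda\ge0$: (P1) $\rho(f)=0\Leftrightarrow f=0$ a.e., $\rho(\lambda f)=\lambda\rho(f)$, $\rho(f+g)\le C_\rho(\rho(f)+\rho(g))$; (P2) $g\le f$ a.e. implies $\rho(g)\le\rho(f)$; (P3) $0\le f_n\nearrow f$ a.e. and $\sup_n\rho(f_n)<\infty$ imply $\rho(f)<\infty$ and $\rho(f_n)\nearrow\rho(f)$; (P4-weak) $\rho(\chi_\omega)<\infty$ for every bounded measurable $\omega\subset(0,L)$. $B=\{f\in\mathfrak M(0,L):\|f\|_B:=\rho(|f|)<\infty\}$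 and $E=\{f\in\mathfrak M(0,L):\|f\|_E:=\rho(f^* )<\infty\}$; $E$ is called an r.i. quasi-Banach function space (it is understood that $f\mapsto\rho(f^* )$ is a quasi-norm on $E$; then the dilation operators below are bounded on $E$). If a $[0,\infty]$-valued measurable function $g$ is infinite on a set of positive measure, $\|g\|_B:=\infty$ and likewise $\rho(g):=\infty$. "$E$ equipped with the quasi-norm $\|Hf\|_B$ is an r.i. quasi-Banach function space" means that $f\mapsto\|Hf\|_B$ is a function quasi-norm on $\mathfrak M^+(0,L)$ with $\|Hf\|_B=\|H(f^* )\|_B$. Dilations: $(D_af)(t)=f(at)\chi_{(0,L)}(at)$, $a>0$, $0<t<L$; $\|D_a\|$ is the norm of $D_a:E\to E$. Boyd indices: $p_E=\sup\{p>0:\exists c>0\ \forall\,0<a<1\ \|D_a\|\le c\,a^{-1/p}\}$, $q_E=\inf\{q>0:\exists c>0\ \forall a\ge1\ \|D_a\|\le c\,a^{-1/q}\}$ ($\inf\emptyset=\infty$); $0<p_E\le q_E\le\infty$. Averaging operators, for $f\in\mathfrak M(0,L)$, $t\in(0,L)$: $$(H^{(U,W;d)}f)(t)=\big(t^{1/U}d(t)\big)^{-1}\big\|v^{\frac1U-\frac1W}d(v)f^*(v)\big\|_{W,(0,t)},$$ $$(H_{(V,W;d)}f)(t)=\big(t^{1/V}d(t)\big)^{-1}\big\|v^{\frac1V-\frac1W}d(v)f^*(v)\big\|_{W,(t,L)}.$$ *)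

theory Defs
  imports "HOL-Probability.Essential_Supremum"
begin

text \<open>
  The underlying interval \<open>(0,L)\<close> is \<^term>\<open>einterval 0 L\<close>. Functions on it are functions on the whole
  real line whose values outside the interval are irrelevant; functions equal almost everywhere are
  not identified by a quotient. Non-negative functions take values in \<^typ>\<open>ennreal\<close>, so that \<open>f\<^sup>*\<close>
  and averages of \<open>f\<^sup>*\<close> are always defined, and finiteness almost everywhere is imposed where needed.
\<close>

abbreviation leb :: "ereal \<Rightarrow> real measure" where
  "leb L \<equiv> lebesgue_on (einterval 0 L)"

definition Mfun :: "ereal \<Rightarrow> (real \<Rightarrow> complex) set" where
  "Mfun L = borel_measurable (leb L)"

definition Mplus :: "ereal \<Rightarrow> (real \<Rightarrow> ennreal) set" where
  "Mplus L = {f \<in> borel_measurable (leb L). AE x in leb L. f x < \<infinity>}"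

definition modulus :: "(real \<Rightarrow> complex) \<Rightarrow> real \<Rightarrow> ennreal" where
  "modulus f = (\<lambda>x. ennreal (cmod (f x)))"

definition rearr :: "ereal \<Rightarrow> (real \<Rightarrow> ennreal) \<Rightarrow> real \<Rightarrow> ennreal" where
  "rearr L f t =
     Inf {ennreal l | l. 0 < l \<and> emeasure lebesgue {x \<in> einterval 0 L. ennreal l < f x} \<le> ennreal t}"

text \<open>The exponent \<open>1/p\<close>; note \<open>1/\<infinity> = 0\<close>.\<close>

definition recip :: "ereal \<Rightarrow> real" where
  "recip p = real_of_ereal (1 / p)"

text \<open>Powers with a positive real exponent.\<close>

definition epowr :: "ennreal \<Rightarrow> real \<Rightarrow> ennreal" where
  "epowr x p = (if x = \<infinity> then \<infinity> else ennreal (enn2real x powr p))"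

definition Lnorm :: "ereal \<Rightarrow> ereal \<Rightarrow> ereal \<Rightarrow> (real \<Rightarrow> ennreal) \<Rightarrow> ennreal" where
  "Lnorm q a b g =
     (if q = \<infinity> then esssup (lebesgue_on (einterval a b)) g
      else epowr (\<integral>\<^sup>+ v. epowr (g v) (real_of_ereal q) \<partial>lebesgue_on (einterval a b)) (recip q))"

definition SV :: "ereal \<Rightarrow> (real \<Rightarrow> real) \<Rightarrow> bool" where
  "SV L d \<longleftrightarrow>
     d \<in> borel_measurable (leb L) \<and> (\<forall>t \<in> einterval 0 L. 0 < d t) \<and>
     (\<forall>e > 0.
        (\<exists>g c C. 0 < c \<and> 0 < C \<and> mono_on (einterval 0 L) g \<and>
           (\<forall>t \<in> einterval 0 L. c * g t \<le> t powr e * d t \<and> t powr e * d t \<le> C * g t)) \<and>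
        (\<exists>g c C. 0 < c \<and> 0 < C \<and> antimono_on (einterval 0 L) g \<and>
           (\<forall>t \<in> einterval 0 L. c * g t \<le> t powr (- e) * d t \<and> t powr (- e) * d t \<le> C * g t)))"

text \<open>Only the values of \<open>\<rho>\<close> on \<^term>\<open>Mplus L\<close> matter.\<close>

definition function_quasinorm :: "ereal \<Rightarrow> ((real \<Rightarrow> ennreal) \<Rightarrow> ennreal) \<Rightarrow> bool" where
  "function_quasinorm L \<rho> \<longleftrightarrow>
     (\<forall>f \<in> Mplus L. \<rho> f = 0 \<longleftrightarrow> (AE x in leb L. f x = 0)) \<and>
     (\<forall>f \<in> Mplus L. \<forall>l::real. 0 \<le> l \<longrightarrow> \<rho> (\<lambda>x. ennreal l * f x) = ennreal l * \<rho> f) \<and>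
     (\<exists>C::real. 1 \<le> C \<and>
        (\<forall>f \<in> Mplus L. \<forall>g \<in> Mplus L. \<rho> (\<lambda>x. f x + g x) \<le> ennreal C * (\<rho> f + \<rho> g))) \<and>
     (\<forall>f \<in> Mplus L. \<forall>g \<in> Mplus L. (AE x in leb L. g x \<le> f x) \<longrightarrow> \<rho> g \<le> \<rho> f) \<and>
     (\<forall>F. \<forall>f \<in> Mplus L.
        (\<forall>n::nat. F n \<in> Mplus L) \<and>
        (AE x in leb L. incseq (\<lambda>n. F n x) \<and> (\<lambda>n. F n x) \<longlonglongrightarrow> f x) \<and>
        (SUP n. \<rho> (F n)) < \<infinity> \<longrightarrow>
        \<rho> f < \<infinity> \<and> incseq (\<lambda>n. \<rho> (F n)) \<and> (\<lambda>n. \<rho> (F n)) \<longlonglongrightarrow> \<rho> f) \<and>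
     (\<forall>w \<in> sets lebesgue. bounded w \<and> w \<subseteq> einterval 0 L \<longrightarrow> \<rho> (indicator w) < \<infinity>)"

text \<open>\<open>\<parallel>g\<parallel>\<^sub>B\<close> for a \<open>[0,\<infinity>]\<close>-valued \<open>g\<close>, with the value \<open>\<infinity>\<close> if \<open>g\<close> is infinite on a non-null set.\<close>

definition B_norm :: "ereal \<Rightarrow> ((real \<Rightarrow> ennreal) \<Rightarrow> ennreal) \<Rightarrow> (real \<Rightarrow> ennreal) \<Rightarrow> ennreal" where
  "B_norm L \<rho> g = (if (AE x in leb L. g x < \<infinity>) then \<rho> g else \<infinity>)"

definition E_norm :: "ereal \<Rightarrow> ((real \<Rightarrow> ennreal) \<Rightarrow> ennreal) \<Rightarrow> (real \<Rightarrow> complex) \<Rightarrow> ennreal" where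
  "E_norm L \<rho> f = B_norm L \<rho> (rearr L (modulus f))"

definition E_space :: "ereal \<Rightarrow> ((real \<Rightarrow> ennreal) \<Rightarrow> ennreal) \<Rightarrow> (real \<Rightarrow> complex) set" where
  "E_space L \<rho> = {f \<in> Mfun L. E_norm L \<rho> f < \<infinity>}"

text \<open>\<open>N\<close> is a quasi-norm on the linear space \<open>X\<close> of measurable functions (modulo null functions).\<close>

definition quasinorm_on ::
    "ereal \<Rightarrow> (real \<Rightarrow> complex) set \<Rightarrow> ((real \<Rightarrow> complex) \<Rightarrow> ennreal) \<Rightarrow> bool" where
  "quasinorm_on L X N \<longleftrightarrow>
     X \<subseteq> Mfun L \<and>
     (\<forall>f \<in> X. \<forall>g \<in> X. (\<lambda>x. f x + g x) \<in> X) \<and> (\<forall>f \<in> X. \<forall>c. (\<lambda>x. c * f x) \<in> X) \<and>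
     (\<forall>f \<in> X. N f < \<infinity>) \<and>
     (\<forall>f \<in> X. N f = 0 \<longleftrightarrow> (AE x in leb L. f x = 0)) \<and>
     (\<forall>f \<in> X. \<forall>c. N (\<lambda>x. c * f x) = ennreal (cmod c) * N f) \<and>
     (\<exists>C::real. 1 \<le> C \<and> (\<forall>f \<in> X. \<forall>g \<in> X. N (\<lambda>x. f x + g x) \<le> ennreal C * (N f + N g)))"

definition equivalent_on :: "'a set \<Rightarrow> ('a \<Rightarrow> ennreal) \<Rightarrow> ('a \<Rightarrow> ennreal) \<Rightarrow> bool" where
  "equivalent_on X F G \<longleftrightarrow>
     (\<exists>c C::real. 0 < c \<and> c \<le> C \<and> (\<forall>f \<in> X. ennreal c * G f \<le> F f \<and> F f \<le> ennreal C * G f))"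

text \<open>
  \<open>X\<close> equipped with \<open>\<lambda>f. N (modulus f)\<close> is a rearrangement-invariant quasi-Banach function space.
  Completeness is not listed: it is a consequence of the Fatou-type property in
  \<^const>\<open>function_quasinorm\<close>.
\<close>

definition ri_qbfs ::
    "ereal \<Rightarrow> (real \<Rightarrow> complex) set \<Rightarrow> ((real \<Rightarrow> ennreal) \<Rightarrow> ennreal) \<Rightarrow> bool" where
  "ri_qbfs L X N \<longleftrightarrow>
     function_quasinorm L N \<and> (\<forall>f \<in> Mplus L. N f = N (rearr L f)) \<and>
     X = {f \<in> Mfun L. N (modulus f) < \<infinity>}"

definition dil :: "ereal \<Rightarrow> real \<Rightarrow> (real \<Rightarrow> complex) \<Rightarrow> real \<Rightarrow> complex" where
  "dil L a f t = (if a * t \<in> einterval 0 L then f (a * t) else 0)"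

definition dil_norm :: "ereal \<Rightarrow> ((real \<Rightarrow> ennreal) \<Rightarrow> ennreal) \<Rightarrow> real \<Rightarrow> ennreal" where
  "dil_norm L \<rho> a = (SUP f \<in> {f \<in> E_space L \<rho>. E_norm L \<rho> f \<le> 1}. E_norm L \<rho> (dil L a f))"

definition lower_Boyd :: "ereal \<Rightarrow> ((real \<Rightarrow> ennreal) \<Rightarrow> ennreal) \<Rightarrow> ereal" where
  "lower_Boyd L \<rho> =
     Sup {ereal p | p. 0 < p \<and>
       (\<exists>c>0. \<forall>a. 0 < a \<and> a < 1 \<longrightarrow> dil_norm L \<rho> a \<le> ennreal (c * a powr (- 1 / p)))}"

definition upper_Boyd :: "ereal \<Rightarrow> ((real \<Rightarrow> ennreal) \<Rightarrow> ennreal) \<Rightarrow> ereal" where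
  "upper_Boyd L \<rho> =
     Inf {ereal q | q. 0 < q \<and>
       (\<exists>c>0. \<forall>a\<ge>1. dil_norm L \<rho> a \<le> ennreal (c * a powr (- 1 / q)))}"

text \<open>
  The averaging operators act on \<open>[0,\<infinity>]\<close>-valued functions; for a complex-valued \<open>f\<close> they are applied
  to \<^term>\<open>modulus f\<close>, which has the same rearrangement.
\<close>

definition H_left ::
    "ereal \<Rightarrow> ereal \<Rightarrow> ereal \<Rightarrow> (real \<Rightarrow> real) \<Rightarrow> (real \<Rightarrow> ennreal) \<Rightarrow> real \<Rightarrow> ennreal" where
  "H_left L U W d f t =
     inverse (ennreal (t powr recip U * d t)) *
     Lnorm W 0 (ereal t) (\<lambda>v. ennreal (v powr (recip U - recip W) * d v) * rearr L f v)"

definition H_right ::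
    "ereal \<Rightarrow> ereal \<Rightarrow> ereal \<Rightarrow> (real \<Rightarrow> real) \<Rightarrow> (real \<Rightarrow> ennreal) \<Rightarrow> real \<Rightarrow> ennreal" where
  "H_right L V W d f t =
     inverse (ennreal (t powr recip V * d t)) *
     Lnorm W (ereal t) L (\<lambda>v. ennreal (v powr (recip V - recip W) * d v) * rearr L f v)"

end

theory Submission
  imports Defs
begin

text \<open>
  On non-increasing right-continuous \<open>h\<close> both operators are compared with dilations of \<open>h\<close>.

  Upper bound. Cutting \<open>(0,t)\<close> or \<open>(t,L)\<close> at the points \<open>t b\<^sup>k\<close> and absorbing \<open>d\<close> by a small power, the
  integrand is at most \<open>t\<^sup>\<alpha> d(t) S(t) (v/t)\<^sup>\<eta> v\<^bsup>-1/W\<^esup>\<close> up to a constant, where \<open>S\<close> is a weighted series of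
  dilations of \<open>h\<close> and \<open>\<eta>\<close> is small, positive for \<open>(0,t)\<close> and negative for \<open>(t,L)\<close>. The \<open>W\<close>-norm of the
  last two factors does not depend on \<open>t\<close>, so the operator is dominated by \<open>S\<close>. The Boyd index bounds the
  norms of the dilations, and taking \<open>b\<close> large makes the terms decay faster than the powers of the
  quasi-norm constant that arise when the triangle inequality is iterated.

  Lower bound. Integrating over \<open>(t/2,t)\<close> only gives \<open>h(t)\<close> up to a constant, and integrating over
  \<open>(t,8t/7)\<close> only gives \<open>h(8t/7)\<close>. In the second case \<open>h\<close> is recovered from its dilation by splitting it
  into two pieces whose rearrangements lie below \<open>h(8t/7)\<close>.

  The remaining properties of the new quasi-norm follow from the equivalence and from monotone convergence
  for rearrangements and for \<open>L\<^sup>W\<close>-norms.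
\<close>

text \<open>As a simplification rule it rewrites sets to their main parts, where the rules about Lebesgue measure
  no longer apply.\<close>

declare emeasure_completion [simp del]

section \<open>Rearrangements\<close>

text \<open>The quasi-norm \<open>\<rho>\<close> need not be rearrangement-invariant, and an average
  of an antitone function need not be antitone. So averages are measured by \<open>\<rho>\<close>
  alone, and the dominating series is summed with the quasi-triangle inequality of
  \<open>\<rho>\<close>. The norm of E enters through single dilations, which stay antitone and
  right-continuous and hence equal their rearrangements. Conversely, the pieces of a split function
  are not antitone, and there the quasi-triangle inequality of E is the right one.

  Let \<open>\<theta>\<close> be the gap between the exponent of the operator (\<open>1 / U\<close>
  or \<open>1 / V\<close>) and the one supplied by the Boyd index. A quarter of it pays for
  \<open>d\<close>, a quarter makes the power integrable against \<open>dv / v\<close>, and the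
  remaining half gives geometric decay: the base satisfies
  \<open>b powr (\<theta> / 2) = 2 * Crho\<close>, so after paying for the powers of
  \<open>Crho\<close> a factor \<open>1 / 2\<close> per term survives.

  The upper index controls dilations with factor at least 1, whereas passing from
  \<open>h(8t/7)\<close> back to \<open>h(t)\<close> is a dilation with factor \<open>7 / 8\<close>;
  hence the splitting.\<close>

lemma ennreal_le_by_levels:
  fixes x y :: ennreal
  assumes "\<And>l. 0 \<le> l \<Longrightarrow> ennreal l < x \<Longrightarrow> ennreal l < y"
  shows "x \<le> y"
proof (rule ccontr)
  assume "\<not> x \<le> y"
  then have "y < x"
    by simp
  from dense[OF this] obtain z where z: "y < z" "z < x"
    by blast
  then have "z \<noteq> top"
    using less_le_trans[OF z(2) top_greatest] by blast
  then obtain l where "0 \<le> l" "z = ennreal l"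
    by (cases z rule: ennreal_cases) simp_all
  then have "z < y"
    using z(2) assms[of l] by simp
  with z(1) show False
    by (simp add: order.strict_iff_not)
qed

lemma ennreal_eq_by_levels:
  fixes x y :: ennreal
  assumes "\<And>l. 0 \<le> l \<Longrightarrow> ennreal l < x \<longleftrightarrow> ennreal l < y"
  shows "x = y"
  using assms by (intro antisym ennreal_le_by_levels) auto

lemma sets_superlevel:
  assumes "f \<in> borel_measurable (leb L)"
  shows "{x \<in> einterval 0 L. (c::ennreal) < f x} \<in> sets lebesgue"
proof -
  have "{x \<in> space (leb L). c < f x} \<in> sets (leb L)"
    using assms by measurable
  then show ?thesis
    by (simp add: sets_restrict_space_iff)
qed

text \<open>Continuity of measure from below along the levels \<open>l + 1 / Suc n\<close> makes the
  distribution function right-continuous, so the infimum defining \<open>rearr\<close> gives an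
  exact equivalence of strict inequalities. With \<open>ennreal_le_by_levels\<close> it turns claims
  about rearrangements into claims about measures of superlevel sets.\<close>

lemma rearr_gt_iff:
  assumes f: "f \<in> borel_measurable (leb L)" and l: "0 \<le> l"
  shows "ennreal l < rearr L f t \<longleftrightarrow> ennreal t < emeasure lebesgue {x \<in> einterval 0 L. ennreal l < f x}"
proof -
  define A where "A c = {x \<in> einterval 0 L. ennreal c < f x}" for c
  have meas: "A c \<in> sets lebesgue" for c
    unfolding A_def using sets_superlevel[OF f] by blast
  have anti: "emeasure lebesgue (A c') \<le> emeasure lebesgue (A c)" if "c \<le> c'" for c c'
    using meas le_less_trans[OF ennreal_leI[OF that]] by (intro emeasure_mono) (auto simp: A_def)
  have "rearr L f t \<le> ennreal l \<longleftrightarrow> emeasure lebesgue (A l) \<le> ennreal t"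
  proof
    assume R: "rearr L f t \<le> ennreal l"
    have bd: "emeasure lebesgue (A (l + 1 / real (Suc n))) \<le> ennreal t" for n
    proof -
      have "rearr L f t < ennreal (l + 1 / real (Suc n))"
        by (rule le_less_trans[OF R]) (use l in \<open>auto intro!: ennreal_lessI add_pos_pos add_nonneg_pos\<close>)
      then obtain c where "0 < c" "ennreal c < ennreal (l + 1 / real (Suc n))"
        "emeasure lebesgue (A c) \<le> ennreal t"
        unfolding rearr_def Inf_less_iff A_def by blast
      then show ?thesis
        using anti[of c "l + 1 / real (Suc n)"] by (simp add: ennreal_less_iff)
    qed
    have "A l = (\<Union>n. A (l + 1 / real (Suc n)))"
    proof (intro equalityI subsetI)
      fix x assume x: "x \<in> A l"
      then have lf: "ennreal l < f x" by (simp add: A_def)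
      obtain n where "ennreal (l + 1 / real (Suc n)) < f x"
      proof (cases "f x")
        case (real r)
        with lf l have "l < r" by (simp add: ennreal_less_iff)
        then obtain n where "1 / real (Suc n) < r - l"
          using nat_approx_posE[of "r - l"] by auto
        then have "l + 1 / real (Suc n) < r" by simp
        with real l \<open>l < r\<close> show ?thesis
          by (intro that[of n]) (simp del: ennreal_plus of_nat_Suc add: ennreal_less_iff)
      qed (use that[of 0] in simp)
      with x show "x \<in> (\<Union>n. A (l + 1 / real (Suc n)))" by (auto simp: A_def)
    next
      fix x assume "x \<in> (\<Union>n. A (l + 1 / real (Suc n)))"
      then obtain n where "x \<in> A (l + 1 / real (Suc n))" by blast
      moreover have "ennreal l \<le> ennreal (l + 1 / real (Suc n))" by (intro ennreal_leI) simp
      ultimately show "x \<in> A l" by (auto simp: A_def)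
    qed
    moreover have "incseq (\<lambda>n. A (l + 1 / real (Suc n)))"
    proof (intro monoI subsetI)
      fix m n :: nat and x assume "m \<le> n" "x \<in> A (l + 1 / real (Suc m))"
      moreover from \<open>m \<le> n\<close> have "ennreal (l + 1 / real (Suc n)) \<le> ennreal (l + 1 / real (Suc m))"
        by (intro ennreal_leI) (simp add: frac_le)
      ultimately show "x \<in> A (l + 1 / real (Suc n))" by (auto simp: A_def)
    qed
    ultimately have "emeasure lebesgue (A l) = (SUP n. emeasure lebesgue (A (l + 1 / real (Suc n))))"
      using SUP_emeasure_incseq[of "\<lambda>n. A (l + 1 / real (Suc n))" lebesgue] meas by (simp del: of_nat_Suc add: image_subset_iff)
    also have "\<dots> \<le> ennreal t" using bd by (intro SUP_least)
    finally show "emeasure lebesgue (A l) \<le> ennreal t" .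
  next
    assume B: "emeasure lebesgue (A l) \<le> ennreal t"
    show "rearr L f t \<le> ennreal l"
    proof (rule ennreal_le_epsilon)
      fix e :: real assume e: "0 < e"
      have "rearr L f t \<le> ennreal (l + e)"
      proof -
        have "emeasure lebesgue (A (l + e)) \<le> ennreal t"
          using order_trans[OF anti[of l "l + e"] B] e by simp
        then show ?thesis
          unfolding rearr_def using e l by (intro Inf_lower) (auto simp: A_def intro!: exI[of _ "l + e"])
      qed
      then show "rearr L f t \<le> ennreal l + ennreal e"
        using l e by simp
    qed
  qed
  then show ?thesis
    unfolding A_def by (metis not_less)
qed

lemma rearr_mono:
  assumes f: "f \<in> borel_measurable (leb L)" and g: "g \<in> borel_measurable (leb L)"
    and le: "AE x in leb L. g x \<le> f x"
  shows "rearr L g t \<le> rearr L f t"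
proof (rule ennreal_le_by_levels)
  fix l :: real assume l: "0 \<le> l" and *: "ennreal l < rearr L g t"
  have "AE x in lebesgue. x \<in> einterval 0 L \<longrightarrow> g x \<le> f x"
    using le by (simp add: AE_restrict_space_iff)
  then have "emeasure lebesgue {x \<in> einterval 0 L. ennreal l < g x}
      \<le> emeasure lebesgue {x \<in> einterval 0 L. ennreal l < f x}"
    by (intro emeasure_mono_AE sets_superlevel f) (elim eventually_mono, simp, metis less_le_trans)
  with * show "ennreal l < rearr L f t"
    by (simp add: rearr_gt_iff f g l)
qed

lemma rearr_cong_AE:
  assumes f: "f \<in> borel_measurable (leb L)" and g: "g \<in> borel_measurable (leb L)"
    and eq: "AE x in leb L. g x = f x"
  shows "rearr L g t = rearr L f t"
  by (intro antisym rearr_mono f g; rule eventually_mono[OF eq]; simp)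

lemma rearr_antimono: "s \<le> t \<Longrightarrow> rearr L f t \<le> rearr L f s"
  unfolding rearr_def using order_trans[OF _ ennreal_leI[of s t]] by (intro Inf_superset_mono) blast

lemma rearr_zero [simp]: "rearr L (\<lambda>x. 0) t = 0"
proof (rule ennreal_eq_by_levels)
  fix l :: real assume l: "0 \<le> l"
  show "ennreal l < rearr L (\<lambda>x. 0) t \<longleftrightarrow> ennreal l < 0"
    unfolding rearr_gt_iff[OF borel_measurable_const l] by simp
qed

lemma rearr_cmult:
  assumes f: "f \<in> borel_measurable (leb L)" and c: "0 \<le> c"
  shows "rearr L (\<lambda>x. ennreal c * f x) t = ennreal c * rearr L f t"
proof (cases "c = 0")
  case True
  then show ?thesis
    by (simp add: rearr_zero)
next
  case False
  with c have c: "0 < c" by simp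
  have lev: "ennreal l < ennreal c * y \<longleftrightarrow> ennreal (l / c) < y" if "0 \<le> l" for l y
  proof (cases y rule: ennreal_cases)
    case (real r)
    then show ?thesis
      using c that by (simp add: ennreal_mult[symmetric] ennreal_less_iff pos_divide_less_eq mult.commute)
  next
    case top
    then show ?thesis
      using c by (simp add: ennreal_mult_top)
  qed
  show ?thesis
  proof (rule ennreal_eq_by_levels)
    fix l :: real assume l: "0 \<le> l"
    have "(\<lambda>x. ennreal c * f x) \<in> borel_measurable (leb L)"
      using f by measurable
    from rearr_gt_iff[OF this l, of t] rearr_gt_iff[OF f, of "l / c" t] l c
    show "(ennreal l < rearr L (\<lambda>x. ennreal c * f x) t) = (ennreal l < ennreal c * rearr L f t)"
      by (simp only: lev divide_nonneg_pos)
  qed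
qed

text \<open>The superlevel set of a supremum is the union of the superlevel sets, and measure is
  continuous along an increasing union. This is the first of the three layers behind the Fatou
  property of the new quasi-norm.\<close>

lemma rearr_SUP:
  assumes F: "\<And>n. F n \<in> borel_measurable (leb L)" and f: "f \<in> borel_measurable (leb L)"
    and conv: "AE x in leb L. incseq (\<lambda>n. F n x) \<and> (\<lambda>n. F n x) \<longlonglongrightarrow> f x"
  shows "incseq (\<lambda>n. rearr L (F n) t)" and "rearr L f t = (SUP n. rearr L (F n) t)"
proof -
  show inc: "incseq (\<lambda>n. rearr L (F n) t)"
    by (intro monoI rearr_mono F, rule eventually_mono[OF conv]) (elim conjE, erule (1) incseqD)
  have SUP_AE: "AE x in leb L. f x = (SUP n. F n x)"
    using conv by eventually_elim (metis LIMSEQ_SUP LIMSEQ_unique)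
  show "rearr L f t = (SUP n. rearr L (F n) t)"
  proof (rule antisym)
    show "(SUP n. rearr L (F n) t) \<le> rearr L f t"
      by (intro SUP_least rearr_mono F f) (rule eventually_mono[OF SUP_AE], erule ssubst, rule SUP_upper, simp)
    show "rearr L f t \<le> (SUP n. rearr L (F n) t)"
    proof (rule ennreal_le_by_levels)
      fix l :: real assume l: "0 \<le> l" and *: "ennreal l < rearr L f t"
      \<comment> \<open>The given sequence increases only almost everywhere. Its running maxima
        increase everywhere and differ from it on null sets, which rearrangements do not
        see.\<close>
      define G where "G n x = (SUP i\<in>{..n}. F i x)" for n x
      have Gm: "G n \<in> borel_measurable (leb L)" for n
        unfolding G_def using F by (intro borel_measurable_SUP) auto
      have GF: "AE x in leb L. G n x = F n x" for n
        using conv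
      proof eventually_elim
        case (elim x)
        then show ?case
          unfolding G_def by (intro antisym SUP_least SUP_upper) (auto dest: incseqD)
      qed
      have Gf: "AE x in leb L. f x = (SUP n. G n x)"
      proof -
        have "AE x in leb L. \<forall>n. G n x = F n x"
          unfolding AE_all_countable using GF by blast
        with SUP_AE show ?thesis by eventually_elim simp
      qed
      have Gs: "(\<lambda>x. SUP n. G n x) \<in> borel_measurable (leb L)"
        using Gm by simp
      have "ennreal l < rearr L (\<lambda>x. SUP n. G n x) t"
        using * rearr_cong_AE[OF Gs f Gf] by simp
      then have "ennreal t < emeasure lebesgue {x \<in> einterval 0 L. ennreal l < (SUP n. G n x)}"
        by (simp add: rearr_gt_iff Gs l)
      also have "{x \<in> einterval 0 L. ennreal l < (SUP n. G n x)} = (\<Union>n. {x \<in> einterval 0 L. ennreal l < G n x})"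
        by (auto simp: less_SUP_iff)
      also have "emeasure lebesgue \<dots> = (SUP n. emeasure lebesgue {x \<in> einterval 0 L. ennreal l < G n x})"
      proof (rule SUP_emeasure_incseq[symmetric])
        show "incseq (\<lambda>n. {x \<in> einterval 0 L. ennreal l < G n x})"
        proof (intro monoI subsetI)
          fix m n :: nat and x
          assume "m \<le> n" and x: "x \<in> {x \<in> einterval 0 L. ennreal l < G m x}"
          then have "G m x \<le> G n x"
            unfolding G_def by (intro SUP_subset_mono) auto
          with x show "x \<in> {x \<in> einterval 0 L. ennreal l < G n x}" by auto
        qed
      qed (use sets_superlevel[OF Gm] in auto)
      finally obtain n where "ennreal t < emeasure lebesgue {x \<in> einterval 0 L. ennreal l < G n x}"
        by (auto simp: less_SUP_iff)
      then have "ennreal l < rearr L (G n) t"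
        by (simp add: rearr_gt_iff Gm l)
      also have "\<dots> = rearr L (F n) t"
        by (rule rearr_cong_AE[OF F Gm GF])
      also have "\<dots> \<le> (SUP n. rearr L (F n) t)"
        by (intro SUP_upper) auto
      finally show "ennreal l < (SUP n. rearr L (F n) t)" .
    qed
  qed
qed

text \<open>The antitone, right-continuous functions: exactly those that equal their rearrangement.\<close>

definition rcdecr :: "ereal \<Rightarrow> (real \<Rightarrow> ennreal) \<Rightarrow> bool" where
  "rcdecr L h \<longleftrightarrow> antimono_on (einterval 0 L) h \<and>
     (\<forall>t\<in>einterval 0 L. \<forall>l<h t. \<exists>s\<in>einterval 0 L. t < s \<and> l < h s)"

lemma emeasure_lebesgue_greaterThanLessThan:
  "emeasure lebesgue {a<..<b::real} = ennreal (b - a)"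
  by (cases "a \<le> b") (simp_all add: emeasure_completion ennreal_neg)

text \<open>Superlevel sets of a monotone function are intervals. Besides rearrangements this serves
  the averages, whose norm factor is monotone in \<open>t\<close>.\<close>

lemma borel_measurable_monotone_on:
  assumes "mono_on (einterval 0 L) h \<or> antimono_on (einterval 0 L) h"
  shows "(h :: real \<Rightarrow> ennreal) \<in> borel_measurable (leb L)"
proof (rule borel_measurableI_greater)
  fix y :: ennreal
  have "is_interval {x \<in> einterval 0 L. y < h x}"
    unfolding is_interval_1
  proof (intro ballI allI impI, elim conjE)
    fix a b x assume ab: "a \<in> {x \<in> einterval 0 L. y < h x}" "b \<in> {x \<in> einterval 0 L. y < h x}" "a \<le> x" "x \<le> b"
    then have x: "x \<in> einterval 0 L"
      by (cases L) (auto simp: einterval_iff zero_ereal_def)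
    with ab have "h a \<le> h x \<or> h b \<le> h x"
      using assms by (auto simp: monotone_on_def)
    with ab x show "x \<in> {x \<in> einterval 0 L. y < h x}"
      by auto
  qed
  then have "{x \<in> einterval 0 L. y < h x} \<in> sets borel"
    using real_interval_borel_measurable by blast
  then show "{x \<in> space (leb L). y < h x} \<in> sets (leb L)"
    by (simp add: sets_restrict_space_iff)
qed


lemmas borel_measurable_antimono_on = borel_measurable_monotone_on[OF disjI2]

lemma emeasure_lebesgue_greaterThanAtMost:
  "a \<le> b \<Longrightarrow> emeasure lebesgue {a<..b::real} = ennreal (b - a)"
  by (simp add: emeasure_completion)

text \<open>If \<open>l\<close> is below the value at \<open>t\<close>, the superlevel set has
  measure above \<open>t\<close>, and at any \<open>s\<close> strictly between the value is still
  above \<open>l\<close>. Such an \<open>s\<close> stays below \<open>L\<close> because the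
  superlevel set lies in the interval.\<close>

lemma rcdecr_rearr:
  assumes f: "f \<in> borel_measurable (leb L)"
  shows "rcdecr L (rearr L f)"
  unfolding rcdecr_def
proof (intro conjI ballI allI impI)
  show "antimono_on (einterval 0 L) (rearr L f)"
    by (auto simp: monotone_on_def intro: rearr_antimono)
  fix t :: real and l :: ennreal
  assume t: "t \<in> einterval 0 L" and l: "l < rearr L f t"
  then have "l \<noteq> top" by auto
  then obtain r where r: "0 \<le> r" "l = ennreal r"
    by (cases l rule: ennreal_cases) simp_all
  let ?m = "emeasure lebesgue {x \<in> einterval 0 L. ennreal r < f x}"
  have "ennreal t < ?m"
    using l rearr_gt_iff[OF f r(1)] by (simp add: r(2))
  from dense[OF this] obtain z where z: "ennreal t < z" "z < ?m"
    by blast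
  then have "z \<noteq> top"
    using less_le_trans[OF z(2) top_greatest] by blast
  then obtain s where s: "0 \<le> s" "z = ennreal s"
    by (cases z rule: ennreal_cases) simp_all
  have "t < s"
    using z(1) t s by (simp add: ennreal_less_iff einterval_iff zero_ereal_def)
  have "ereal s < L"
  proof (cases L)
    case (real b)
    have "?m \<le> emeasure lebesgue {0<..<b}"
      by (intro emeasure_mono) (auto simp: real zero_ereal_def)
    also have "\<dots> = ennreal b"
      by (simp add: emeasure_lebesgue_greaterThanLessThan)
    finally have "ennreal s < ennreal b"
      using z(2) s by (simp add: less_le_trans)
    then show ?thesis
      using s real by (simp add: ennreal_less_iff)
  qed (use t in \<open>auto simp: einterval_iff\<close>)
  with t \<open>t < s\<close> have "s \<in> einterval 0 L"
    by (auto simp: einterval_iff zero_ereal_def)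
  moreover have "l < rearr L f s"
    using z(2) rearr_gt_iff[OF f r(1)] by (simp add: r(2) s(2))
  ultimately show "\<exists>s\<in>einterval 0 L. t < s \<and> l < rearr L f s"
    using \<open>t < s\<close> by blast
qed

lemma rcdecr_measurable: "rcdecr L h \<Longrightarrow> h \<in> borel_measurable (leb L)"
  by (simp add: rcdecr_def borel_measurable_antimono_on)

lemma rcdecr_mono: "rcdecr L h \<Longrightarrow> s \<in> einterval 0 L \<Longrightarrow> t \<in> einterval 0 L \<Longrightarrow> s \<le> t \<Longrightarrow> h t \<le> h s"
  by (auto simp: rcdecr_def monotone_on_def)

text \<open>If \<open>h t\<close> does not exceed \<open>l\<close>, the superlevel set is contained
  in \<open>(0,t]\<close>. Otherwise right-continuity supplies \<open>s > t\<close> with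
  \<open>(0,s)\<close> inside it, which gives the strict inequality of measures that antitonicity
  alone would not.\<close>

lemma rearr_rcdecr:
  assumes h: "rcdecr L h" and t: "t \<in> einterval 0 L"
  shows "rearr L h t = h t"
proof (rule ennreal_eq_by_levels)
  fix l :: real assume l: "0 \<le> l"
  let ?A = "{x \<in> einterval 0 L. ennreal l < h x}"
  have t0: "0 < t"
    using t by (simp add: einterval_iff zero_ereal_def)
  have "ennreal t < emeasure lebesgue ?A \<longleftrightarrow> ennreal l < h t"
  proof
    assume *: "ennreal t < emeasure lebesgue ?A"
    show "ennreal l < h t"
    proof (rule ccontr)
      assume n: "\<not> ennreal l < h t"
      have "x \<le> t" if "x \<in> ?A" for x
      proof (rule ccontr)
        assume "\<not> x \<le> t"
        then have "h x \<le> h t"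
          using that rcdecr_mono[OF h t, of x] by simp
        moreover have "ennreal l < h x"
          using that by simp
        ultimately show False
          using n less_le_trans by blast
      qed
      then have "?A \<subseteq> {0<..t}"
        by (auto simp: einterval_iff zero_ereal_def)
      then have "emeasure lebesgue ?A \<le> emeasure lebesgue {0<..t}"
        by (intro emeasure_mono) auto
      also have "\<dots> = ennreal t"
        using t0 by (simp add: emeasure_lebesgue_greaterThanAtMost)
      finally show False using * by simp
    qed
  next
    assume "ennreal l < h t"
    then obtain s where s: "s \<in> einterval 0 L" "t < s" "ennreal l < h s"
      using h t unfolding rcdecr_def by blast
    have "{0<..<s} \<subseteq> ?A"
    proof
      fix x assume x: "x \<in> {0<..<s}"
      then have "x \<in> einterval 0 L"
        using s by (cases L) (auto simp: einterval_iff zero_ereal_def)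
      with x s show "x \<in> ?A"
        using rcdecr_mono[OF h, of x s] by auto
    qed
    then have "emeasure lebesgue {0<..<s} \<le> emeasure lebesgue ?A"
      by (intro emeasure_mono sets_superlevel rcdecr_measurable h)
    moreover have "ennreal t < ennreal s"
      using s t0 by (simp add: ennreal_less_iff)
    ultimately show "ennreal t < emeasure lebesgue ?A"
      by (simp add: emeasure_lebesgue_greaterThanLessThan)
  qed
  then show "ennreal l < rearr L h t \<longleftrightarrow> ennreal l < h t"
    by (simp add: rearr_gt_iff[OF rcdecr_measurable[OF h] l])
qed

text \<open>The product agrees on the interval with its own rearrangement, so right-continuity is
  inherited from \<open>rcdecr_rearr\<close>.\<close>

lemma rcdecr_cmult:
  assumes h: "rcdecr L h" and c: "0 \<le> c"
  shows "rcdecr L (\<lambda>x. ennreal c * h x)"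
proof -
  let ?g = "\<lambda>x. ennreal c * h x"
  have *: "rearr L ?g t = ?g t" if "t \<in> einterval 0 L" for t
    using rearr_cmult[OF rcdecr_measurable[OF h] c] rearr_rcdecr[OF h that] by simp
  have "rcdecr L (rearr L ?g)"
    by (intro rcdecr_rearr) (use rcdecr_measurable[OF h] in measurable)
  then show ?thesis
    unfolding rcdecr_def monotone_on_def by (simp add: * cong: ball_cong)
qed

section \<open>Dilations of antitone right-continuous functions\<close>

definition edil :: "ereal \<Rightarrow> real \<Rightarrow> (real \<Rightarrow> ennreal) \<Rightarrow> real \<Rightarrow> ennreal" where
  "edil L a h t = (if a * t \<in> einterval 0 L then h (a * t) else 0)"

lemma mult_in_einterval0:
  assumes "x \<in> einterval 0 L" "0 < y" "y \<le> x"
  shows "y \<in> einterval 0 L"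
  using assms by (cases L) (auto simp: einterval_iff zero_ereal_def)

lemma einterval0_larger:
  assumes "t \<in> einterval 0 L"
  obtains u where "u \<in> einterval 0 L" "t < u"
proof (cases L)
  case (real b)
  then show ?thesis
    using assms that[of "(t + b) / 2"] by (simp add: einterval_iff zero_ereal_def)
next
  case PInf
  then show ?thesis
    using assms that[of "t + 1"] by (simp add: einterval_iff zero_ereal_def)
qed (use assms in \<open>simp add: einterval_iff\<close>)

lemma rcdecr_edil:
  assumes h: "rcdecr L h" and a: "0 < a"
  shows "rcdecr L (edil L a h)"
  unfolding rcdecr_def
proof (intro conjI ballI allI impI)
  show "antimono_on (einterval 0 L) (edil L a h)"
  proof (rule monotone_onI)
    fix s t assume st: "s \<in> einterval 0 L" "t \<in> einterval 0 L" "s \<le> t"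
    show "edil L a h t \<le> edil L a h s"
    proof (cases "a * t \<in> einterval 0 L")
      case True
      have "a * s \<le> a * t" "0 < a * s"
        using a st by (auto simp: einterval_iff zero_ereal_def)
      moreover from this have "a * s \<in> einterval 0 L"
        using mult_in_einterval0[OF True] by blast
      ultimately show ?thesis
        using True rcdecr_mono[OF h] by (simp add: edil_def)
    qed (simp add: edil_def)
  qed
  fix t :: real and l :: ennreal
  assume t: "t \<in> einterval 0 L" and l: "l < edil L a h t"
  then have at: "a * t \<in> einterval 0 L" and "l < h (a * t)"
    by (auto simp: edil_def split: if_splits)
  then obtain s where s: "s \<in> einterval 0 L" "a * t < s" "l < h s"
    using h unfolding rcdecr_def by blast
  show "\<exists>s\<in>einterval 0 L. t < s \<and> l < edil L a h s"
  proof (cases "s / a \<in> einterval 0 L")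
    case True
    then show ?thesis
      using s a by (intro bexI[of _ "s / a"]) (auto simp: edil_def field_simps)
  next
    \<comment> \<open>Now \<open>s / a\<close> lies beyond the right end, so every point
      \<open>u > t\<close> of the interval satisfies \<open>a * u < s\<close> and can serve as
      witness.\<close>
    case False
    obtain u where u: "u \<in> einterval 0 L" "t < u"
      using einterval0_larger[OF t] by blast
    have "u < s / a"
    proof (rule ccontr)
      assume "\<not> u < s / a"
      moreover have "0 < s / a"
        using s a by (simp add: einterval_iff zero_ereal_def)
      ultimately show False
        using False mult_in_einterval0[OF u(1), of "s / a"] by simp
    qed
    then have "a * u < s"
      using a by (simp add: field_simps)
    moreover have "0 < a * u"
      using a u by (simp add: einterval_iff zero_ereal_def)
    ultimately have au: "a * u \<in> einterval 0 L"
      using mult_in_einterval0[OF s(1), of "a * u"] by simp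
    have "h s \<le> h (a * u)"
      using rcdecr_mono[OF h au s(1)] \<open>a * u < s\<close> by simp
    with s(3) u au show ?thesis
      by (intro bexI[of _ u]) (simp_all add: edil_def)
  qed
qed

section \<open>Function quasi-norms\<close>

text \<open>Every \<open>(0,t)\<close> has positive measure. For an antitone function this upgrades
  finiteness or vanishing almost everywhere to every point: a good point to the left of
  \<open>t\<close> bounds the value at \<open>t\<close>.\<close>

lemma AE_leb_ex:
  assumes ae: "AE x in leb L. P x" and t: "t \<in> einterval 0 L"
  obtains x where "x \<in> einterval 0 L" "x < t" "P x"
proof -
  have "\<exists>x. x \<in> einterval 0 L \<and> x < t \<and> P x"
  proof (rule ccontr)
    assume n: "\<not> ?thesis"
    have t0: "0 < t"
      using t by (simp add: einterval_iff zero_ereal_def)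
    have sub: "x \<in> einterval 0 L" if "x \<in> {0<..<t}" for x
      using that mult_in_einterval0[OF t, of x] by simp
    have "AE x in lebesgue. x \<in> einterval 0 L \<longrightarrow> P x"
      using ae by (simp add: AE_restrict_space_iff)
    then have "AE x in lebesgue. x \<notin> {0<..<t}"
    proof eventually_elim
      case (elim x)
      then show ?case using n sub by auto
    qed
    then have "emeasure lebesgue {0<..<t} = 0"
      using AE_iff_null_sets[of "{0<..<t}" lebesgue] by (simp add: null_setsD1)
    then show False
      using t0 by (simp add: emeasure_lebesgue_greaterThanLessThan)
  qed
  then show ?thesis
    using that by blast
qed

lemma rcdecr_AE_less_top:
  assumes h: "rcdecr L h" and fin: "AE x in leb L. h x < \<infinity>" and t: "t \<in> einterval 0 L"
  shows "h t < \<infinity>"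
proof -
  obtain x where x: "x \<in> einterval 0 L" "x < t" "h x < \<infinity>"
    using AE_leb_ex[OF fin t] by blast
  have "h t \<le> h x"
    using rcdecr_mono[OF h x(1) t] x(2) by simp
  then show ?thesis
    using x(3) by (rule le_less_trans)
qed

lemma rcdecr_AE_zero:
  assumes h: "rcdecr L h" and z: "AE x in leb L. h x = 0" and t: "t \<in> einterval 0 L"
  shows "h t = 0"
proof -
  obtain x where x: "x \<in> einterval 0 L" "x < t" "h x = 0"
    using AE_leb_ex[OF z t] by blast
  have "h t \<le> h x"
    using rcdecr_mono[OF h x(1) t] x(2) by simp
  with x(3) show ?thesis
    by simp
qed

lemma MplusD: "f \<in> Mplus L \<Longrightarrow> f \<in> borel_measurable (leb L)" "f \<in> Mplus L \<Longrightarrow> AE x in leb L. f x < \<infinity>"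
  by (simp_all add: Mplus_def)

lemma AE_leb_I: "(\<And>x. x \<in> einterval 0 L \<Longrightarrow> P x) \<Longrightarrow> AE x in leb L. P x"
  by (rule AE_I2) simp

locale function_qnorm =
  fixes L :: ereal and \<rho> :: "(real \<Rightarrow> ennreal) \<Rightarrow> ennreal"
  assumes fq: "function_quasinorm L \<rho>"
begin

lemmas fq_unfolded = fq[unfolded function_quasinorm_def]

lemma rho_zero_iff: "f \<in> Mplus L \<Longrightarrow> \<rho> f = 0 \<longleftrightarrow> (AE x in leb L. f x = 0)"
  using conjunct1[OF fq_unfolded] by blast

lemma rho_cmult: "f \<in> Mplus L \<Longrightarrow> 0 \<le> l \<Longrightarrow> \<rho> (\<lambda>x. ennreal l * f x) = ennreal l * \<rho> f"
  using conjunct1[OF conjunct2[OF fq_unfolded]] by blast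

lemma rho_mono: "f \<in> Mplus L \<Longrightarrow> g \<in> Mplus L \<Longrightarrow> AE x in leb L. g x \<le> f x \<Longrightarrow> \<rho> g \<le> \<rho> f"
  using fq unfolding function_quasinorm_def by blast

lemma rho_Fatou:
  assumes "f \<in> Mplus L" "\<And>n. F n \<in> Mplus L"
    and "AE x in leb L. incseq (\<lambda>n. F n x) \<and> (\<lambda>n. F n x) \<longlonglongrightarrow> f x"
    and "(SUP n. \<rho> (F n)) < \<infinity>"
  shows "\<rho> f = (SUP n. \<rho> (F n))"
proof -
  have "incseq (\<lambda>n. \<rho> (F n)) \<and> (\<lambda>n. \<rho> (F n)) \<longlonglongrightarrow> \<rho> f"
    using fq assms unfolding function_quasinorm_def by blast
  then show ?thesis
    using LIMSEQ_SUP LIMSEQ_unique by blast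
qed

lemma rho_bounded: "w \<in> sets lebesgue \<Longrightarrow> bounded w \<Longrightarrow> w \<subseteq> einterval 0 L \<Longrightarrow> \<rho> (indicator w) < \<infinity>"
  using fq unfolding function_quasinorm_def by blast

lemma B_norm_finiteD: "B_norm L \<rho> f < \<infinity> \<Longrightarrow> (AE x in leb L. f x < \<infinity>) \<and> B_norm L \<rho> f = \<rho> f"
  by (auto simp: B_norm_def split: if_splits)

lemma B_norm_mono:
  assumes f: "f \<in> borel_measurable (leb L)" and g: "g \<in> borel_measurable (leb L)"
    and le: "AE x in leb L. g x \<le> f x"
  shows "B_norm L \<rho> g \<le> B_norm L \<rho> f"
proof (cases "AE x in leb L. f x < \<infinity>")
  case True
  then have "AE x in leb L. g x < \<infinity>"
    using le by eventually_elim (rule le_less_trans)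
  with True show ?thesis
    using rho_mono[of f g] f g le by (simp add: B_norm_def Mplus_def)
qed (simp add: B_norm_def)

lemma B_norm_cong:
  assumes "f \<in> borel_measurable (leb L)" "g \<in> borel_measurable (leb L)"
    and "\<And>x. x \<in> einterval 0 L \<Longrightarrow> g x = f x"
  shows "B_norm L \<rho> g = B_norm L \<rho> f"
  using assms by (intro antisym B_norm_mono AE_leb_I) auto

lemma B_norm_zero: "B_norm L \<rho> (\<lambda>x. 0) = 0"
  using rho_zero_iff[of "\<lambda>x. 0"] by (simp add: B_norm_def Mplus_def)

lemma B_norm_cmult:
  assumes f: "f \<in> borel_measurable (leb L)" and c: "0 \<le> c"
  shows "B_norm L \<rho> (\<lambda>x. ennreal c * f x) = ennreal c * B_norm L \<rho> f"
proof (cases "c = 0")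
  case True
  then show ?thesis by (simp add: B_norm_zero)
next
  case False
  then have "ennreal c * y < top \<longleftrightarrow> y < top" for y
    using c by (auto simp: ennreal_mult_less_top)
  then show ?thesis
    using rho_cmult[OF _ c, of f] f c False by (simp add: B_norm_def Mplus_def ennreal_mult_top)
qed

text \<open>The limit in the Fatou property may a priori be infinite on a set of positive measure. Truncating
  the sequence by multiples of the indicator of such a set shows that this does not happen.\<close>

lemma B_norm_SUP:
  assumes F: "\<And>n. F n \<in> borel_measurable (leb L)" and f: "f \<in> borel_measurable (leb L)"
    and inc: "\<And>x. x \<in> einterval 0 L \<Longrightarrow> incseq (\<lambda>n. F n x)"
    and sup: "\<And>x. x \<in> einterval 0 L \<Longrightarrow> f x = (SUP n. F n x)"
  shows "B_norm L \<rho> f = (SUP n. B_norm L \<rho> (F n))"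
proof (rule antisym)
  show "(SUP n. B_norm L \<rho> (F n)) \<le> B_norm L \<rho> f"
    by (intro SUP_least B_norm_mono F f AE_leb_I) (auto simp: sup intro: SUP_upper)
  show "B_norm L \<rho> f \<le> (SUP n. B_norm L \<rho> (F n))"
  proof (cases "(SUP n. B_norm L \<rho> (F n)) < \<infinity>")
    case True
    then have "B_norm L \<rho> (F n) < \<infinity>" for n
      by (rule le_less_trans[rotated]) (intro SUP_upper, simp)
    then have FM: "F n \<in> Mplus L" and FB: "B_norm L \<rho> (F n) = \<rho> (F n)" for n
      using B_norm_finiteD[of "F n"] F[of n] by (simp_all add: Mplus_def)
    let ?K = "SUP n. \<rho> (F n)"
    have K: "?K < \<infinity>"
      using True by (simp add: FB)
    have lim: "(\<lambda>n. F n x) \<longlonglongrightarrow> f x" if "x \<in> einterval 0 L" for x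
      using LIMSEQ_SUP[OF inc[OF that]] sup[OF that] by simp
    \<comment> \<open>The cut to \<open>(0,k)\<close> makes the indicator have finite quasi-norm; a
      finite number whose multiples all stay below \<open>?K\<close> must vanish.\<close>
    have null: "emeasure lebesgue {x \<in> einterval 0 L \<inter> {0<..<real k}. f x = \<infinity>} = 0" for k :: nat
    proof -
      define A where "A = {x \<in> einterval 0 L \<inter> {0<..<real k}. f x = \<infinity>}"
      have "A = {0<..<real k} \<inter> {x \<in> space (leb L). f x = \<infinity>}"
        by (auto simp: A_def)
      moreover have "{x \<in> space (leb L). f x = \<infinity>} \<in> sets (leb L)"
        using f by measurable
      ultimately have A: "A \<in> sets lebesgue"
        by (auto simp: sets_restrict_space_iff intro!: sets.Int)
      have AI: "A \<subseteq> einterval 0 L" "bounded A"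
        by (auto simp: A_def intro: bounded_subset[of "{0<..<real k}"])
      have Am: "(indicator A :: real \<Rightarrow> ennreal) \<in> borel_measurable (leb L)"
        using A AI by (intro borel_measurable_indicator) (simp add: sets_restrict_space_iff)
      have AM: "(indicator A :: real \<Rightarrow> ennreal) \<in> Mplus L"
        using Am by (auto simp: Mplus_def indicator_def less_top[symmetric])
      have bd: "of_nat m * \<rho> (indicator A) \<le> ?K" for m :: nat
      proof -
        let ?g = "\<lambda>x. ennreal (real m) * indicator A x"
        let ?G = "\<lambda>n x. min (F n x) (?g x)"
        have gM: "?g \<in> Mplus L"
        proof -
          have "?g \<in> borel_measurable (leb L)"
            using Am by measurable
          moreover have "?g x < \<infinity>" for x
            by (simp add: indicator_def)
          ultimately show ?thesis
            by (simp add: Mplus_def)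
        qed
        have GM: "?G n \<in> Mplus L" for n
          using gM F[of n] by (auto simp: Mplus_def min_less_iff_disj)
        have le: "\<rho> (?G n) \<le> \<rho> (F n)" for n
          by (rule rho_mono[OF FM GM]) simp
        then have Gb: "(SUP n. \<rho> (?G n)) \<le> ?K"
          by (intro SUP_mono) auto
        have "\<rho> ?g = (SUP n. \<rho> (?G n))"
        proof (rule rho_Fatou[OF gM GM])
          show "(SUP n. \<rho> (?G n)) < \<infinity>"
            using Gb K by (rule le_less_trans)
          show "AE x in leb L. incseq (\<lambda>n. ?G n x) \<and> (\<lambda>n. ?G n x) \<longlonglongrightarrow> ?g x"
          proof (rule AE_leb_I)
            fix x assume x: "x \<in> einterval 0 L"
            have "incseq (\<lambda>n. ?G n x)"
              using inc[OF x] unfolding incseq_def by (intro allI impI min.mono) simp_all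
            moreover have "(\<lambda>n. ?G n x) \<longlonglongrightarrow> min (f x) (?g x)"
              by (intro tendsto_min lim x tendsto_const)
            moreover have "min (f x) (?g x) = ?g x"
              by (cases "x \<in> A") (auto simp: A_def min_def top_unique)
            ultimately show "incseq (\<lambda>n. ?G n x) \<and> (\<lambda>n. ?G n x) \<longlonglongrightarrow> ?g x"
              by simp
          qed
        qed
        with Gb rho_cmult[OF AM, of "real m"] show ?thesis
          by (simp add: ennreal_of_nat_eq_real_of_nat)
      qed
      have "\<rho> (indicator A) = 0"
      proof (rule ccontr)
        assume "\<rho> (indicator A) \<noteq> 0"
        moreover have "\<rho> (indicator A) \<noteq> top"
          using rho_bounded[OF A AI(2,1)] by simp
        ultimately obtain r where r: "0 < r" "\<rho> (indicator A) = ennreal r"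
          by (cases "\<rho> (indicator A)" rule: ennreal_cases) (auto simp: less_le)
        obtain K' where K': "0 \<le> K'" "?K = ennreal K'"
          using K by (cases ?K rule: ennreal_cases) auto
        obtain m where m: "K' < real m * r"
          using reals_Archimedean3[OF r(1)] by blast
        have "ennreal (real m * r) \<le> ennreal K'"
          using bd[of m] r K' by (simp add: ennreal_of_nat_eq_real_of_nat ennreal_mult)
        with m K' show False
          by simp
      qed
      then have "AE x in leb L. indicator A x = (0::ennreal)"
        using rho_zero_iff[OF AM] by simp
      then have "AE x in lebesgue. x \<notin> A"
        using AI by (auto simp: AE_restrict_space_iff indicator_def elim!: eventually_mono)
      then have "emeasure lebesgue A = 0"
        using AE_iff_null_sets[OF A] by (simp add: null_setsD1)
      then show ?thesis
        by (simp add: A_def)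
    qed
    have "AE x in lebesgue. \<forall>k. x \<notin> {x \<in> einterval 0 L \<inter> {0<..<real k}. f x = \<infinity>}"
      unfolding AE_all_countable
    proof
      fix k :: nat
      have "{x \<in> space (leb L). f x = \<infinity>} \<in> sets (leb L)"
        using f by measurable
      then have "{0<..<real k} \<inter> {x \<in> einterval 0 L. f x = \<infinity>} \<in> sets lebesgue"
        by (intro sets.Int) (simp_all add: sets_restrict_space_iff)
      moreover have "{0<..<real k} \<inter> {x \<in> einterval 0 L. f x = \<infinity>} = {x \<in> einterval 0 L \<inter> {0<..<real k}. f x = \<infinity>}"
        by auto
      ultimately have "{x \<in> einterval 0 L \<inter> {0<..<real k}. f x = \<infinity>} \<in> null_sets lebesgue"
        using null[of k] by (auto simp: null_sets_def)
      then show "AE x in lebesgue. x \<notin> {x \<in> einterval 0 L \<inter> {0<..<real k}. f x = \<infinity>}"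
        by (rule AE_not_in)
    qed
    then have "AE x in lebesgue. x \<in> einterval 0 L \<longrightarrow> f x < \<infinity>"
    proof eventually_elim
      case (elim x)
      show ?case
      proof
        assume x: "x \<in> einterval 0 L"
        obtain k :: nat where "x < real k"
          using reals_Archimedean2 by blast
        with x elim show "f x < \<infinity>"
          by (auto simp: einterval_iff zero_ereal_def less_top[symmetric])
      qed
    qed
    then have fin: "AE x in leb L. f x < \<infinity>"
      by (simp add: AE_restrict_space_iff)
    then have fM: "f \<in> Mplus L"
      using f by (simp add: Mplus_def)
    have "\<rho> f = ?K"
      by (rule rho_Fatou[OF fM FM AE_leb_I K]) (use inc lim in blast)
    then show ?thesis
      unfolding FB using fin by (simp add: B_norm_def)
  next
    case False
    then have "(SUP n. B_norm L \<rho> (F n)) = \<infinity>"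
      unfolding infinity_ennreal_def less_top[symmetric] by blast
    then show ?thesis
      by (simp only: top_greatest infinity_ennreal_def)
  qed
qed

text \<open>One admissible constant is fixed as a term because the base of the dilations and the
  weights of the series are built from it.\<close>

definition Crho :: real where
  "Crho = (SOME C. 1 \<le> C \<and> (\<forall>f \<in> Mplus L. \<forall>g \<in> Mplus L. \<rho> (\<lambda>x. f x + g x) \<le> ennreal C * (\<rho> f + \<rho> g)))"

lemma Crho: "1 \<le> Crho"
    "f \<in> Mplus L \<Longrightarrow> g \<in> Mplus L \<Longrightarrow> \<rho> (\<lambda>x. f x + g x) \<le> ennreal Crho * (\<rho> f + \<rho> g)"
proof -
  have "\<exists>C. 1 \<le> C \<and> (\<forall>f \<in> Mplus L. \<forall>g \<in> Mplus L. \<rho> (\<lambda>x. f x + g x) \<le> ennreal C * (\<rho> f + \<rho> g))"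
    using fq unfolding function_quasinorm_def by blast
  from someI_ex[OF this, folded Crho_def]
  show "1 \<le> Crho" "f \<in> Mplus L \<Longrightarrow> g \<in> Mplus L \<Longrightarrow> \<rho> (\<lambda>x. f x + g x) \<le> ennreal Crho * (\<rho> f + \<rho> g)"
    by blast+
qed

lemma B_norm_add:
  assumes f: "f \<in> borel_measurable (leb L)" and g: "g \<in> borel_measurable (leb L)"
  shows "B_norm L \<rho> (\<lambda>x. f x + g x) \<le> ennreal Crho * (B_norm L \<rho> f + B_norm L \<rho> g)"
proof (cases "(AE x in leb L. f x < \<infinity>) \<and> (AE x in leb L. g x < \<infinity>)")
  case True
  then have "AE x in leb L. f x < \<infinity> \<and> g x < \<infinity>"
    by auto
  then have "AE x in leb L. f x + g x < \<infinity>"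
    by eventually_elim simp
  with True show ?thesis
    using Crho(2)[of f g] f g by (simp add: B_norm_def Mplus_def)
next
  case False
  then have "B_norm L \<rho> f + B_norm L \<rho> g = top"
    by (auto simp: B_norm_def)
  then show ?thesis
    using Crho(1) by (simp only: ennreal_mult_top) simp
qed

text \<open>Splitting off the first summand costs one factor \<open>Crho\<close> on it and on all
  that remain, so term \<open>k\<close> pays \<open>Crho ^ Suc k\<close>. The weight depends on
  \<open>k\<close> but not on \<open>n\<close>, which permits the passage to infinite
  series.\<close>

lemma B_norm_sum:
  assumes "\<And>k. g k \<in> borel_measurable (leb L)"
  shows "B_norm L \<rho> (\<lambda>x. \<Sum>k<n. g k x) \<le> (\<Sum>k<n. ennreal (Crho ^ Suc k) * B_norm L \<rho> (g k))"
  using assms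
proof (induction n arbitrary: g)
  case 0
  then show ?case by (simp add: B_norm_zero)
next
  case (Suc n)
  have C0: "0 \<le> Crho" using Crho(1) by simp
  have "B_norm L \<rho> (\<lambda>x. \<Sum>k<Suc n. g k x) = B_norm L \<rho> (\<lambda>x. g 0 x + (\<Sum>k<n. g (Suc k) x))"
    by (simp only: sum.lessThan_Suc_shift)
  also have "\<dots> \<le> ennreal Crho * (B_norm L \<rho> (g 0) + B_norm L \<rho> (\<lambda>x. \<Sum>k<n. g (Suc k) x))"
    using Suc.prems by (intro B_norm_add borel_measurable_sum) auto
  also have "\<dots> \<le> ennreal Crho * (B_norm L \<rho> (g 0) + (\<Sum>k<n. ennreal (Crho ^ Suc k) * B_norm L \<rho> (g (Suc k))))"
    using Suc.prems by (intro mult_left_mono add_left_mono Suc.IH) auto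
  also have "\<dots> = (\<Sum>k<Suc n. ennreal (Crho ^ Suc k) * B_norm L \<rho> (g k))"
    using C0 by (simp add: sum.lessThan_Suc_shift distrib_left sum_distrib_left ennreal_mult mult.assoc
        del: sum.lessThan_Suc)
  finally show ?case .
qed

lemma B_norm_suminf:
  assumes g: "\<And>k. g k \<in> borel_measurable (leb L)"
  shows "B_norm L \<rho> (\<lambda>x. \<Sum>k. g k x) \<le> (\<Sum>k. ennreal (Crho ^ Suc k) * B_norm L \<rho> (g k))"
proof -
  have "B_norm L \<rho> (\<lambda>x. \<Sum>k. g k x) = (SUP n. B_norm L \<rho> (\<lambda>x. \<Sum>k<n. g k x))"
  proof (rule B_norm_SUP)
    show "(\<lambda>x. \<Sum>k. g k x) \<in> borel_measurable (leb L)" "(\<lambda>x. \<Sum>k<n. g k x) \<in> borel_measurable (leb L)" for n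
      using g by measurable
    show "incseq (\<lambda>n. \<Sum>k<n. g k x)" for x
      by (intro monoI sum_mono2) auto
    show "(\<Sum>k. g k x) = (SUP n. \<Sum>k<n. g k x)" for x
      by (rule suminf_eq_SUP)
  qed
  also have "\<dots> \<le> (SUP n. \<Sum>k<n. ennreal (Crho ^ Suc k) * B_norm L \<rho> (g k))"
    by (intro SUP_subset_mono B_norm_sum g subset_refl)
  also have "\<dots> = (\<Sum>k. ennreal (Crho ^ Suc k) * B_norm L \<rho> (g k))"
    by (rule suminf_eq_SUP[symmetric])
  finally show ?thesis .
qed

end

section \<open>Rearrangement-invariant spaces and their dilations\<close>

text \<open>The hypotheses on \<open>E_space\<close> and \<open>dil_norm\<close> speak of
  complex-valued functions; this is the bridge from non-negative ones. \<open>enn2real\<close> sends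
  \<open>\<infinity>\<close> to 0, which is harmless for functions that are finite almost
  everywhere.\<close>

definition cplx :: "(real \<Rightarrow> ennreal) \<Rightarrow> real \<Rightarrow> complex" where
  "cplx h x = complex_of_real (enn2real (h x))"

lemma cplx_Mfun: "h \<in> borel_measurable (leb L) \<Longrightarrow> cplx h \<in> Mfun L"
  unfolding Mfun_def cplx_def by measurable

lemma modulus_cplx: "h x < \<infinity> \<Longrightarrow> modulus (cplx h) x = h x"
  by (simp add: modulus_def cplx_def)

lemma modulus_Mplus: "\<phi> \<in> Mfun L \<Longrightarrow> modulus \<phi> \<in> Mplus L"
  unfolding Mplus_def Mfun_def modulus_def by (auto intro!: AE_I2)

lemma modulus_measurable: "\<phi> \<in> Mfun L \<Longrightarrow> modulus \<phi> \<in> borel_measurable (leb L)"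
  by (rule MplusD(1)[OF modulus_Mplus])

lemma modulus_cmult: "modulus (\<lambda>x. c * \<phi> x) = (\<lambda>x. ennreal (cmod c) * modulus \<phi> x)"
  by (simp add: modulus_def fun_eq_iff norm_mult ennreal_mult)

lemma Mfun_add: "\<phi> \<in> Mfun L \<Longrightarrow> \<psi> \<in> Mfun L \<Longrightarrow> (\<lambda>x. \<phi> x + \<psi> x) \<in> Mfun L"
  unfolding Mfun_def by measurable

lemma Mplus_add:
  assumes "f \<in> Mplus L" "g \<in> Mplus L"
  shows "(\<lambda>x. f x + g x) \<in> Mplus L"
proof -
  have "AE x in leb L. f x + g x < \<infinity>"
    using MplusD(2)[OF assms(1)] MplusD(2)[OF assms(2)] by eventually_elim simp
  then show ?thesis
    using assms by (auto simp: Mplus_def)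
qed

lemma rearr_modulus_cplx:
  assumes h: "h \<in> Mplus L"
  shows "rearr L (modulus (cplx h)) t = rearr L h t"
proof (rule rearr_cong_AE)
  show "h \<in> borel_measurable (leb L)" "modulus (cplx h) \<in> borel_measurable (leb L)"
    using h by (simp_all add: MplusD(1) cplx_Mfun modulus_measurable)
  show "AE x in leb L. modulus (cplx h) x = h x"
    using MplusD(2)[OF h] by eventually_elim (rule modulus_cplx)
qed

lemma antimono_rearr: "antimono_on (einterval 0 L) (rearr L f)"
  by (rule monotone_onI) (rule rearr_antimono)

lemma rearr_measurable: "rearr L f \<in> borel_measurable (leb L)"
  by (rule borel_measurable_antimono_on[OF antimono_rearr])

text \<open>Reduces the norm in E of the indicator of a bounded set to \<open>\<rho>\<close> of the
  indicator of a bounded initial interval, where (P4-weak) applies.\<close>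

lemma rearr_indicator_le:
  assumes w: "w \<in> sets lebesgue" "w \<subseteq> einterval 0 L" and r: "emeasure lebesgue w \<le> ennreal r"
    and t: "t \<in> einterval 0 L"
  shows "rearr L (indicator w) t \<le> indicator (einterval 0 L \<inter> {0<..r}) t"
proof (rule ennreal_le_by_levels)
  fix l :: real assume l: "0 \<le> l" and *: "ennreal l < rearr L (indicator w) t"
  have t0: "0 < t"
    using t by (simp add: einterval_iff zero_ereal_def)
  have "(indicator w :: real \<Rightarrow> ennreal) \<in> borel_measurable (leb L)"
    using w by (intro borel_measurable_indicator) (simp add: sets_restrict_space_iff)
  with * l have m: "ennreal t < emeasure lebesgue {x \<in> einterval 0 L. ennreal l < indicator w x}"
    by (simp add: rearr_gt_iff)
  then have "{x \<in> einterval 0 L. ennreal l < indicator w x} \<noteq> {}"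
    by (metis emeasure_empty not_less_zero)
  then obtain x where "ennreal l < indicator w x"
    by blast
  also have "indicator w x \<le> (1::ennreal)"
    by (simp add: indicator_def)
  finally have "ennreal l < 1" .
  have "emeasure lebesgue {x \<in> einterval 0 L. ennreal l < indicator w x} \<le> emeasure lebesgue w"
    by (intro emeasure_mono w) (auto simp: indicator_def split: if_splits)
  with m r have "ennreal t < ennreal r"
    by (meson less_le_trans)
  then have "t \<le> r"
    using t0 by (simp add: ennreal_less_iff)
  with t t0 \<open>ennreal l < 1\<close> show "ennreal l < indicator (einterval 0 L \<inter> {0<..r}) t"
    by simp
qed

section \<open>The quasi-norm of E on non-negative functions\<close>

locale ri_qnorm = function_qnorm +
  assumes qn: "quasinorm_on L (E_space L \<rho>) (E_norm L \<rho>)"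
begin

abbreviation EN :: "(real \<Rightarrow> ennreal) \<Rightarrow> ennreal" where
  "EN f \<equiv> B_norm L \<rho> (rearr L f)"

lemma EN_mono: "f \<in> Mplus L \<Longrightarrow> g \<in> Mplus L \<Longrightarrow> AE x in leb L. g x \<le> f x \<Longrightarrow> EN g \<le> EN f"
  by (rule B_norm_mono[OF rearr_measurable rearr_measurable AE_leb_I]) (rule rearr_mono[OF MplusD(1) MplusD(1)])

lemma E_norm_cplx: "h \<in> Mplus L \<Longrightarrow> E_norm L \<rho> (cplx h) = EN h"
  using rearr_modulus_cplx[of h L] by (auto simp: E_norm_def intro: arg_cong[where f = "B_norm L \<rho>"])

lemma EN_add:
  obtains C where "1 \<le> C"
    "\<And>f g. f \<in> Mplus L \<Longrightarrow> g \<in> Mplus L \<Longrightarrow> EN (\<lambda>x. f x + g x) \<le> ennreal C * (EN f + EN g)"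
proof -
  obtain C :: real where C: "1 \<le> C" "\<And>f g. f \<in> E_space L \<rho> \<Longrightarrow> g \<in> E_space L \<rho> \<Longrightarrow>
      E_norm L \<rho> (\<lambda>x. f x + g x) \<le> ennreal C * (E_norm L \<rho> f + E_norm L \<rho> g)"
    using qn unfolding quasinorm_on_def by (elim conjE) blast
  show ?thesis
  proof (rule that[OF C(1)])
    fix f g assume f: "f \<in> Mplus L" and g: "g \<in> Mplus L"
    show "EN (\<lambda>x. f x + g x) \<le> ennreal C * (EN f + EN g)"
    proof (cases "EN f < \<infinity> \<and> EN g < \<infinity>")
      case True
      then have E: "cplx f \<in> E_space L \<rho>" "cplx g \<in> E_space L \<rho>"
        using f g by (simp_all add: E_space_def E_norm_cplx cplx_Mfun MplusD)
      have "EN (\<lambda>x. f x + g x) \<le> EN (modulus (\<lambda>x. cplx f x + cplx g x))"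
      proof (rule EN_mono)
        show "modulus (\<lambda>x. cplx f x + cplx g x) \<in> Mplus L"
          using f g by (intro modulus_Mplus Mfun_add cplx_Mfun MplusD)
        show "AE x in leb L. f x + g x \<le> modulus (\<lambda>x. cplx f x + cplx g x) x"
          using MplusD(2)[OF f] MplusD(2)[OF g]
        proof eventually_elim
          case (elim x)
          then obtain a b where "f x = ennreal a" "0 \<le> a" "g x = ennreal b" "0 \<le> b"
            by (cases "f x" rule: ennreal_cases; cases "g x" rule: ennreal_cases) auto
          then show ?case
            by (simp add: modulus_def cplx_def flip: of_real_add ennreal_plus)
        qed
      qed (intro Mplus_add f g)
      also have "\<dots> = E_norm L \<rho> (\<lambda>x. cplx f x + cplx g x)"
        by (simp add: E_norm_def)
      also have "\<dots> \<le> ennreal C * (EN f + EN g)"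
        using C(2)[OF E] f g by (simp add: E_norm_cplx)
      finally show ?thesis .
    next
      case False
      then have "EN f + EN g = top"
        by (auto simp: less_top[symmetric])
      then show ?thesis
        using C(1) by (simp only: ennreal_mult_top) simp
    qed
  qed
qed

lemma EN_zero_iff:
  assumes f: "f \<in> Mplus L"
  shows "EN f = 0 \<longleftrightarrow> (AE x in leb L. f x = 0)"
proof
  assume z: "EN f = 0"
  then have "cplx f \<in> E_space L \<rho>"
    using f by (simp add: E_space_def E_norm_cplx cplx_Mfun MplusD)
  moreover have "\<forall>f \<in> E_space L \<rho>. E_norm L \<rho> f = 0 \<longleftrightarrow> (AE x in leb L. f x = 0)"
    using qn unfolding quasinorm_on_def by (elim conjE)
  ultimately have "E_norm L \<rho> (cplx f) = 0 \<longleftrightarrow> (AE x in leb L. cplx f x = 0)"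
    by blast
  then have "AE x in leb L. cplx f x = 0"
    using z E_norm_cplx[OF f] by simp
  then show "AE x in leb L. f x = 0"
    using MplusD(2)[OF f]
    by eventually_elim (auto simp: cplx_def enn2real_eq_0_iff)
next
  assume "AE x in leb L. f x = 0"
  then have "rearr L f = rearr L (\<lambda>x. 0)"
    by (intro ext rearr_cong_AE MplusD(1)[OF f] borel_measurable_const)
  also have "\<dots> = (\<lambda>x. 0)"
    by (simp add: fun_eq_iff)
  finally show "EN f = 0"
    by (simp add: B_norm_zero)
qed

lemma EN_indicator:
  assumes w: "w \<in> sets lebesgue" "bounded w" "w \<subseteq> einterval 0 L"
  shows "EN (indicator w) < \<infinity>"
proof -
  have "w \<in> lmeasurable"
    using w by (intro bounded_set_imp_lmeasurable)
  then have "emeasure lebesgue w < \<infinity>"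
    by (simp add: fmeasurable_def)
  then obtain r where r: "emeasure lebesgue w = ennreal r"
    by (cases "emeasure lebesgue w" rule: ennreal_cases) auto
  define A where "A = einterval 0 L \<inter> {0<..r}"
  have A: "A \<in> sets lebesgue" "bounded A" "A \<subseteq> einterval 0 L"
    by (auto simp: A_def intro: bounded_subset[of "{0<..r}"])
  have Am: "(indicator A :: real \<Rightarrow> ennreal) \<in> borel_measurable (leb L)"
    using A by (intro borel_measurable_indicator) (simp add: sets_restrict_space_iff)
  have "EN (indicator w) \<le> B_norm L \<rho> (indicator A)"
    by (intro B_norm_mono rearr_measurable Am AE_leb_I) (simp add: A_def rearr_indicator_le w r)
  also have "\<dots> < \<infinity>"
    using rho_bounded[OF A] by (simp add: B_norm_def indicator_def)
  finally show ?thesis .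
qed

lemma E_norm_rcdecr:
  assumes h: "rcdecr L h" and \<phi>: "\<phi> \<in> Mfun L" and eq: "\<And>x. x \<in> einterval 0 L \<Longrightarrow> modulus \<phi> x = h x"
  shows "E_norm L \<rho> \<phi> = B_norm L \<rho> h"
  unfolding E_norm_def
proof (rule B_norm_cong[OF rcdecr_measurable[OF h] rearr_measurable])
  fix x assume x: "x \<in> einterval 0 L"
  have "rearr L (modulus \<phi>) x = rearr L h x"
    by (rule rearr_cong_AE[OF rcdecr_measurable[OF h] modulus_measurable[OF \<phi>] AE_leb_I[OF eq]])
  also have "\<dots> = h x"
    by (rule rearr_rcdecr[OF h x])
  finally show "rearr L (modulus \<phi>) x = h x" .
qed

text \<open>\<open>dil_norm\<close> is a supremum over the unit ball, so \<open>h\<close> is scaled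
  to norm 1. Both the scaled function and its dilation equal their rearrangements, hence their norms
  in E are values of \<open>B_norm\<close>. Norm 0 escapes the scaling and is settled separately:
  then \<open>h\<close> vanishes at every point of the interval.\<close>

lemma B_norm_edil:
  assumes h: "rcdecr L h" and fin: "B_norm L \<rho> h < \<infinity>" and a: "0 < a"
  shows "B_norm L \<rho> (edil L a h) \<le> dil_norm L \<rho> a * B_norm L \<rho> h"
proof -
  have h_fin: "h x < \<infinity>" if "x \<in> einterval 0 L" for x
    by (rule rcdecr_AE_less_top[OF h _ that]) (use B_norm_finiteD[OF fin] in blast)
  have hM: "h \<in> Mplus L"
    using rcdecr_measurable[OF h] AE_leb_I[OF h_fin] by (simp add: Mplus_def)
  obtain r where r: "0 \<le> r" "B_norm L \<rho> h = ennreal r"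
    using fin by (cases "B_norm L \<rho> h" rule: ennreal_cases) auto
  show ?thesis
  proof (cases "r = 0")
    case True
    then have "B_norm L \<rho> h = 0"
      using r by simp
    then have "\<rho> h = 0"
      using B_norm_finiteD[OF fin] by metis
    then have "AE x in leb L. h x = 0"
      using rho_zero_iff[OF hM] by blast
    then have "h x = 0" if "x \<in> einterval 0 L" for x
      using that by (rule rcdecr_AE_zero[OF h])
    then have "edil L a h x = 0" for x
      by (simp add: edil_def)
    then have "edil L a h = (\<lambda>x. 0)"
      by (simp add: fun_eq_iff)
    then show ?thesis
      by (simp add: B_norm_zero)
  next
    case False
    with r have r0: "0 < r" by simp
    define k where "k = (\<lambda>x. ennreal (1 / r) * h x)"
    have k: "rcdecr L k"
      unfolding k_def using r0 by (intro rcdecr_cmult h) simp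
    have k_fin: "k x < \<infinity>" if "x \<in> einterval 0 L" for x
      using h_fin[OF that] by (simp add: k_def ennreal_mult_less_top)
    have dk: "rcdecr L (edil L a k)"
      by (rule rcdecr_edil[OF k a])
    have "B_norm L \<rho> k = ennreal (1 / r) * ennreal r"
      unfolding k_def using r0 r B_norm_cmult[OF rcdecr_measurable[OF h], of "1 / r"] by simp
    also have "\<dots> = 1"
      using r0 by (simp flip: ennreal_mult)
    finally have k1: "B_norm L \<rho> k = 1" .
    have ck: "cplx k \<in> Mfun L"
      by (rule cplx_Mfun[OF rcdecr_measurable[OF k]])
    have "E_norm L \<rho> (cplx k) = 1"
      unfolding k1[symmetric] by (rule E_norm_rcdecr[OF k ck modulus_cplx[OF k_fin]])
    with ck have "E_norm L \<rho> (dil L a (cplx k)) \<le> dil_norm L \<rho> a"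
      unfolding dil_norm_def by (intro SUP_upper) (simp add: E_space_def)
    moreover have "dil L a (cplx k) = cplx (edil L a k)"
      by (simp add: fun_eq_iff dil_def cplx_def edil_def)
    moreover have "E_norm L \<rho> (cplx (edil L a k)) = B_norm L \<rho> (edil L a k)"
    proof (rule E_norm_rcdecr[OF dk cplx_Mfun[OF rcdecr_measurable[OF dk]]])
      fix x
      have "edil L a k x < \<infinity>"
        using k_fin by (simp add: edil_def)
      then show "modulus (cplx (edil L a k)) x = edil L a k x"
        by (rule modulus_cplx)
    qed
    moreover have "edil L a k = (\<lambda>x. ennreal (1 / r) * edil L a h x)"
      by (simp add: fun_eq_iff edil_def k_def)
    ultimately have "ennreal (1 / r) * B_norm L \<rho> (edil L a h) \<le> dil_norm L \<rho> a"
      using B_norm_cmult[OF rcdecr_measurable[OF rcdecr_edil[OF h a]], of "1 / r"] r0 by simp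
    then have "ennreal r * (ennreal (1 / r) * B_norm L \<rho> (edil L a h)) \<le> ennreal r * dil_norm L \<rho> a"
      by (rule mult_left_mono) simp
    moreover have "ennreal r * (ennreal (1 / r) * y) = y" for y
      using r0 by (simp add: mult.assoc[symmetric] ennreal_mult[symmetric])
    ultimately show ?thesis
      using r by (simp add: mult.commute)
  qed
qed

end

text \<open>Isolates what turns a two-sided comparison with \<open>EN\<close> into a full set of
  quasi-norm properties; both operators become instances. No subadditivity of \<open>T\<close> is
  asked for: the quasi-triangle inequality is borrowed from \<open>EN_add\<close>, at the price of
  \<open>K\<close> twice.\<close>

locale ri_operator = ri_qnorm +
  fixes T :: "(real \<Rightarrow> ennreal) \<Rightarrow> real \<Rightarrow> ennreal" and K :: real
  assumes T_measurable: "antimono_on (einterval 0 L) h \<Longrightarrow> T h \<in> borel_measurable (leb L)"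
    and T_mono: "antimono_on (einterval 0 L) g \<Longrightarrow> antimono_on (einterval 0 L) h \<Longrightarrow>
      (\<And>x. x \<in> einterval 0 L \<Longrightarrow> g x \<le> h x) \<Longrightarrow> t \<in> einterval 0 L \<Longrightarrow> T g t \<le> T h t"
    and T_cmult: "antimono_on (einterval 0 L) h \<Longrightarrow> 0 \<le> c \<Longrightarrow> t \<in> einterval 0 L \<Longrightarrow>
      T (\<lambda>x. ennreal c * h x) t = ennreal c * T h t"
    and T_SUP: "(\<And>n. antimono_on (einterval 0 L) (G n)) \<Longrightarrow>
      (\<And>x. x \<in> einterval 0 L \<Longrightarrow> incseq (\<lambda>n. G n x)) \<Longrightarrow> t \<in> einterval 0 L \<Longrightarrow>
      T (\<lambda>x. SUP n. G n x) t = (SUP n. T (G n) t)"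
    and K_pos: "0 < K"
    and EN_le: "f \<in> Mplus L \<Longrightarrow> EN f \<le> ennreal K * B_norm L \<rho> (T (rearr L f))"
    and le_EN: "f \<in> Mplus L \<Longrightarrow> B_norm L \<rho> (T (rearr L f)) \<le> ennreal K * EN f"
begin

abbreviation N :: "(real \<Rightarrow> ennreal) \<Rightarrow> ennreal" where
  "N f \<equiv> B_norm L \<rho> (T (rearr L f))"

lemma T_rearr_measurable: "T (rearr L f) \<in> borel_measurable (leb L)"
  by (rule T_measurable[OF antimono_rearr])

lemma N_finite_iff: "f \<in> Mplus L \<Longrightarrow> N f < \<infinity> \<longleftrightarrow> EN f < \<infinity>"
  using EN_le[of f] le_EN[of f]
  by (metis ennreal_less_top ennreal_mult_less_top infinity_ennreal_def le_less_trans)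

lemma N_zero_iff: "f \<in> Mplus L \<Longrightarrow> N f = 0 \<longleftrightarrow> (AE x in leb L. f x = 0)"
  using EN_le[of f] le_EN[of f] EN_zero_iff[of f] by (metis le_zero_eq mult_zero_right)

lemma N_mono:
  assumes "f \<in> Mplus L" "g \<in> Mplus L" "AE x in leb L. g x \<le> f x"
  shows "N g \<le> N f"
  by (intro B_norm_mono T_rearr_measurable AE_leb_I T_mono antimono_rearr rearr_mono assms
      MplusD(1)[OF assms(1)] MplusD(1)[OF assms(2)])

lemma N_cmult:
  assumes f: "f \<in> Mplus L" and l: "0 \<le> l"
  shows "N (\<lambda>x. ennreal l * f x) = ennreal l * N f"
proof -
  have eq: "rearr L (\<lambda>x. ennreal l * f x) = (\<lambda>x. ennreal l * rearr L f x)"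
    by (intro ext rearr_cmult MplusD f l)
  have "N (\<lambda>x. ennreal l * f x) = B_norm L \<rho> (\<lambda>x. ennreal l * T (rearr L f) x)"
  proof (rule B_norm_cong[OF _ T_rearr_measurable])
    show "(\<lambda>x. ennreal l * T (rearr L f) x) \<in> borel_measurable (leb L)"
      using T_rearr_measurable[of f] by measurable
    show "T (rearr L (\<lambda>x. ennreal l * f x)) x = ennreal l * T (rearr L f) x" if "x \<in> einterval 0 L" for x
      unfolding eq by (rule T_cmult[OF antimono_rearr l that])
  qed
  then show ?thesis
    using B_norm_cmult[OF T_rearr_measurable l] by simp
qed

lemma N_add:
  obtains C where "1 \<le> C"
    "\<And>f g. f \<in> Mplus L \<Longrightarrow> g \<in> Mplus L \<Longrightarrow> N (\<lambda>x. f x + g x) \<le> ennreal C * (N f + N g)"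
proof -
  obtain C where C: "1 \<le> C"
    "\<And>f g. f \<in> Mplus L \<Longrightarrow> g \<in> Mplus L \<Longrightarrow> EN (\<lambda>x. f x + g x) \<le> ennreal C * (EN f + EN g)"
    using EN_add by metis
  have "N (\<lambda>x. f x + g x) \<le> ennreal (max 1 (K * C * K)) * (N f + N g)"
    if f: "f \<in> Mplus L" and g: "g \<in> Mplus L" for f g
  proof -
    have "N (\<lambda>x. f x + g x) \<le> ennreal K * EN (\<lambda>x. f x + g x)"
      by (intro le_EN Mplus_add f g)
    also have "\<dots> \<le> ennreal K * (ennreal C * (EN f + EN g))"
      by (intro mult_left_mono C f g) simp
    also have "\<dots> \<le> ennreal K * (ennreal C * (ennreal K * N f + ennreal K * N g))"
      by (intro mult_left_mono add_mono EN_le f g) simp_all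
    also have "\<dots> = ennreal (K * C * K) * (N f + N g)"
      using K_pos C(1) by (simp add: ennreal_mult distrib_left mult.assoc)
    also have "\<dots> \<le> ennreal (max 1 (K * C * K)) * (N f + N g)"
      by (intro mult_right_mono ennreal_leI) simp_all
    finally show ?thesis .
  qed
  then show ?thesis
    by (intro that[of "max 1 (K * C * K)"]) simp_all
qed

text \<open>An equivalent quasi-norm does not inherit convergence of norms, so the limit is passed
  exactly through each of the three layers: rearrangement, \<open>T\<close> and
  \<open>B_norm\<close>.\<close>

lemma N_SUP:
  assumes F: "\<And>n. F n \<in> Mplus L" and f: "f \<in> Mplus L"
    and conv: "AE x in leb L. incseq (\<lambda>n. F n x) \<and> (\<lambda>n. F n x) \<longlonglongrightarrow> f x"
  shows "N f = (SUP n. N (F n))"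
proof -
  note inc = rearr_SUP(1)[OF MplusD(1)[OF F] MplusD(1)[OF f] conv]
  have "rearr L f = (\<lambda>x. SUP n. rearr L (F n) x)"
    by (rule ext, rule rearr_SUP(2)[OF MplusD(1)[OF F] MplusD(1)[OF f] conv])
  then have sup: "T (rearr L f) x = (SUP n. T (rearr L (F n)) x)" if "x \<in> einterval 0 L" for x
    using T_SUP[of "\<lambda>n. rearr L (F n)", OF antimono_rearr inc that] by simp
  show ?thesis
  proof (rule B_norm_SUP[OF T_rearr_measurable T_rearr_measurable _ sup])
    fix x assume x: "x \<in> einterval 0 L"
    show "incseq (\<lambda>n. T (rearr L (F n)) x)"
      by (intro monoI T_mono antimono_rearr x incseqD[OF inc])
  qed
qed

lemma function_quasinorm_N: "function_quasinorm L N"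
  unfolding function_quasinorm_def
proof (intro conjI)
  show "\<forall>f\<in>Mplus L. N f = 0 \<longleftrightarrow> (AE x in leb L. f x = 0)"
    using N_zero_iff by blast
  show "\<forall>f\<in>Mplus L. \<forall>l::real. 0 \<le> l \<longrightarrow> N (\<lambda>x. ennreal l * f x) = ennreal l * N f"
    using N_cmult by blast
  show "\<exists>C::real. 1 \<le> C \<and> (\<forall>f\<in>Mplus L. \<forall>g\<in>Mplus L. N (\<lambda>x. f x + g x) \<le> ennreal C * (N f + N g))"
    using N_add by metis
  show "\<forall>f\<in>Mplus L. \<forall>g\<in>Mplus L. (AE x in leb L. g x \<le> f x) \<longrightarrow> N g \<le> N f"
    using N_mono by blast
  show "\<forall>w\<in>sets lebesgue. bounded w \<and> w \<subseteq> einterval 0 L \<longrightarrow> N (indicator w) < \<infinity>"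
  proof (intro ballI impI, elim conjE)
    fix w :: "real set" assume w: "w \<in> sets lebesgue" "bounded w" "w \<subseteq> einterval 0 L"
    have "(indicator w :: real \<Rightarrow> ennreal) \<in> Mplus L"
      using w unfolding Mplus_def
      by (auto intro!: borel_measurable_indicator AE_I2 simp: sets_restrict_space_iff indicator_def)
    then show "N (indicator w) < \<infinity>"
      using EN_indicator[OF w] N_finite_iff by blast
  qed
  show "\<forall>F. \<forall>f\<in>Mplus L. (\<forall>n::nat. F n \<in> Mplus L) \<and>
      (AE x in leb L. incseq (\<lambda>n. F n x) \<and> (\<lambda>n. F n x) \<longlonglongrightarrow> f x) \<and> (SUP n. N (F n)) < \<infinity> \<longrightarrow>
      N f < \<infinity> \<and> incseq (\<lambda>n. N (F n)) \<and> (\<lambda>n. N (F n)) \<longlonglongrightarrow> N f"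
  proof (intro allI ballI impI, elim conjE)
    fix F :: "nat \<Rightarrow> real \<Rightarrow> ennreal" and f
    assume f: "f \<in> Mplus L" and F: "\<forall>n. F n \<in> Mplus L"
      and conv: "AE x in leb L. incseq (\<lambda>n. F n x) \<and> (\<lambda>n. F n x) \<longlonglongrightarrow> f x"
      and fin: "(SUP n. N (F n)) < \<infinity>"
    have eq: "N f = (SUP n. N (F n))"
      by (rule N_SUP[OF _ f conv]) (use F in blast)
    have inc: "incseq (\<lambda>n. N (F n))"
    proof (rule monoI)
      fix m n :: nat assume "m \<le> n"
      then have "AE x in leb L. F m x \<le> F n x"
        using conv by (elim eventually_mono) (auto dest: incseqD)
      then show "N (F m) \<le> N (F n)"
        using F by (intro N_mono) auto
    qed
    then show "N f < \<infinity> \<and> incseq (\<lambda>n. N (F n)) \<and> (\<lambda>n. N (F n)) \<longlonglongrightarrow> N f"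
      using LIMSEQ_SUP[OF inc] fin by (simp only: eq)
  qed
qed

lemma E_space_eq: "E_space L \<rho> = {f \<in> Mfun L. N (modulus f) < \<infinity>}"
  using N_finite_iff[OF modulus_Mplus] by (auto simp: E_space_def E_norm_def)

lemma ri_qbfs_N: "ri_qbfs L (E_space L \<rho>) N"
  unfolding ri_qbfs_def
proof (intro conjI ballI function_quasinorm_N E_space_eq)
  fix f assume f: "f \<in> Mplus L"
  \<comment> \<open>The two functions agree on the interval only, so their images under
    \<open>T\<close> are compared by \<open>T_mono\<close> in both directions and not by
    substitution.\<close>
  have idem: "rearr L (rearr L f) x = rearr L f x" if "x \<in> einterval 0 L" for x
    by (rule rearr_rcdecr[OF rcdecr_rearr that]) (rule MplusD(1)[OF f])
  show "N f = N (rearr L f)"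
    by (intro B_norm_cong T_rearr_measurable antisym T_mono antimono_rearr) (simp_all add: idem)
qed

lemma quasinorm_on_N: "quasinorm_on L (E_space L \<rho>) (\<lambda>f. N (modulus f))"
  unfolding quasinorm_on_def
proof (intro conjI)
  note q = qn[unfolded quasinorm_on_def]
  show "E_space L \<rho> \<subseteq> Mfun L" "\<forall>f\<in>E_space L \<rho>. \<forall>g\<in>E_space L \<rho>. (\<lambda>x. f x + g x) \<in> E_space L \<rho>"
    "\<forall>f\<in>E_space L \<rho>. \<forall>c. (\<lambda>x. c * f x) \<in> E_space L \<rho>"
    by (rule conjunct1[OF q], rule conjunct1[OF conjunct2[OF q]], rule conjunct1[OF conjunct2[OF conjunct2[OF q]]])
  have M: "modulus f \<in> Mplus L" if "f \<in> E_space L \<rho>" for f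
    using that by (simp add: E_space_def modulus_Mplus)
  show "\<forall>f\<in>E_space L \<rho>. N (modulus f) < \<infinity>"
    by (simp add: E_space_eq)
  show "\<forall>f\<in>E_space L \<rho>. N (modulus f) = 0 \<longleftrightarrow> (AE x in leb L. f x = 0)"
    by (simp add: N_zero_iff M) (simp add: modulus_def)
  show "\<forall>f\<in>E_space L \<rho>. \<forall>c. N (modulus (\<lambda>x. c * f x)) = ennreal (cmod c) * N (modulus f)"
    by (simp add: modulus_cmult N_cmult M)
  obtain C where C: "1 \<le> C"
    "\<And>f g. f \<in> Mplus L \<Longrightarrow> g \<in> Mplus L \<Longrightarrow> N (\<lambda>x. f x + g x) \<le> ennreal C * (N f + N g)"
    using N_add by metis
  have "N (modulus (\<lambda>x. f x + g x)) \<le> ennreal C * (N (modulus f) + N (modulus g))"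
    if f: "f \<in> E_space L \<rho>" and g: "g \<in> E_space L \<rho>" for f g
  proof -
    have "N (modulus (\<lambda>x. f x + g x)) \<le> N (\<lambda>x. modulus f x + modulus g x)"
    proof (rule N_mono[OF Mplus_add[OF M[OF f] M[OF g]]])
      show "modulus (\<lambda>x. f x + g x) \<in> Mplus L"
        using f g by (intro modulus_Mplus Mfun_add) (simp_all add: E_space_def)
      have "modulus (\<lambda>x. f x + g x) x \<le> modulus f x + modulus g x" for x
        by (simp add: modulus_def norm_triangle_ineq ennreal_leI flip: ennreal_plus)
      then show "AE x in leb L. modulus (\<lambda>x. f x + g x) x \<le> modulus f x + modulus g x"
        by (rule AE_I2)
    qed
    also have "\<dots> \<le> ennreal C * (N (modulus f) + N (modulus g))"
      by (intro C M f g)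
    finally show ?thesis .
  qed
  with C(1) show "\<exists>C::real. 1 \<le> C \<and> (\<forall>f\<in>E_space L \<rho>. \<forall>g\<in>E_space L \<rho>.
      N (modulus (\<lambda>x. f x + g x)) \<le> ennreal C * (N (modulus f) + N (modulus g)))"
    by blast
qed

lemma equivalent_on_N: "equivalent_on (Mfun L) (E_norm L \<rho>) (\<lambda>f. N (modulus f))"
  unfolding equivalent_on_def
proof (intro exI conjI ballI)
  \<comment> \<open>At least 1, so that the lower constant \<open>1 / ?K\<close> does not exceed the
    upper one.\<close>
  let ?K = "max 1 K"
  have "1 / ?K \<le> 1" "1 \<le> ?K"
    by simp_all
  then show "1 / ?K \<le> ?K"
    by (rule order_trans)
  show "0 < 1 / ?K"
    by simp
  fix f assume f: "f \<in> Mfun L"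
  have KK: "ennreal K * y \<le> ennreal ?K * y" for y
    by (intro mult_right_mono ennreal_leI) simp_all
  have "ennreal (1 / ?K) * N (modulus f) \<le> ennreal (1 / ?K) * (ennreal ?K * EN (modulus f))"
    by (intro mult_left_mono order_trans[OF le_EN KK] modulus_Mplus f) simp
  also have "\<dots> = EN (modulus f)"
    by (simp add: mult.assoc[symmetric] ennreal_mult[symmetric])
  finally show "ennreal (1 / ?K) * N (modulus f) \<le> E_norm L \<rho> f"
    by (simp add: E_norm_def)
  show "E_norm L \<rho> f \<le> ennreal ?K * N (modulus f)"
    unfolding E_norm_def by (intro order_trans[OF EN_le KK] modulus_Mplus f)
qed

end

section \<open>Averaging operators\<close>

lemma ident_measurable_leb [measurable]: "(\<lambda>v::real. v) \<in> borel_measurable (lebesgue_on A)"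
  by (intro measurable_restrict_space1 measurable_completion) simp

lemma epowr_measurable [measurable]: "(\<lambda>x. epowr x p) \<in> borel_measurable borel"
  unfolding epowr_def by measurable

lemma epowr_ennreal: "0 \<le> r \<Longrightarrow> epowr (ennreal r) p = ennreal (r powr p)"
  by (simp add: epowr_def)

lemma epowr_top [simp]: "epowr top p = top"
  by (simp add: epowr_def)

lemma epowr_mono:
  assumes "x \<le> y" "0 \<le> p"
  shows "epowr x p \<le> epowr y p"
  using assms
  by (cases x rule: ennreal_cases; cases y rule: ennreal_cases)
     (auto simp: epowr_ennreal top_unique intro!: ennreal_leI powr_mono2)

lemma epowr_mult:
  assumes "0 < p"
  shows "epowr (x * y) p = epowr x p * epowr y p"
proof (cases x rule: ennreal_cases)
  case x: (real a)
  show ?thesis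
  proof (cases y rule: ennreal_cases)
    case (real b)
    then show ?thesis
      using x by (simp add: epowr_ennreal powr_mult flip: ennreal_mult)
  next
    case top
    then show ?thesis
      using x by (cases "a = 0") (auto simp: epowr_ennreal epowr_def[of 0] ennreal_mult_top)
  qed
next
  case top
  then show ?thesis
    by (cases y rule: ennreal_cases)
      (auto simp: epowr_ennreal epowr_def[of 0] ennreal_top_mult le_less)
qed

lemma epowr_epowr:
  assumes "0 < p"
  shows "epowr (epowr x p) (1 / p) = x"
  using assms by (cases x rule: ennreal_cases) (simp_all add: epowr_ennreal powr_powr)

text \<open>\<open>epowr\<close> with a positive exponent is monotone and has the monotone inverse
  with exponent \<open>1 / p\<close>, hence commutes with suprema.\<close>

lemma epowr_SUP:
  assumes p: "0 < p"
  shows "epowr (SUP n. X n) p = (SUP n. epowr (X n) p)"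
proof (rule antisym)
  show "(SUP n. epowr (X n) p) \<le> epowr (SUP n. X n) p"
    using p by (intro SUP_least epowr_mono SUP_upper) auto
  have "X n \<le> epowr (SUP n. epowr (X n) p) (1 / p)" for n
  proof -
    have "X n = epowr (epowr (X n) p) (1 / p)"
      using p by (simp add: epowr_epowr)
    also have "\<dots> \<le> epowr (SUP n. epowr (X n) p) (1 / p)"
      using p by (intro epowr_mono SUP_upper) auto
    finally show ?thesis .
  qed
  then have "(SUP n. X n) \<le> epowr (SUP n. epowr (X n) p) (1 / p)"
    by (rule SUP_least)
  then have "epowr (SUP n. X n) p \<le> epowr (epowr (SUP n. epowr (X n) p) (1 / p)) p"
    using p by (intro epowr_mono) auto
  also have "\<dots> = (SUP n. epowr (X n) p)"
    using epowr_epowr[of "1 / p"] p by simp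
  finally show "epowr (SUP n. X n) p \<le> (SUP n. epowr (X n) p)" .
qed

lemma recip_pos: "0 < W \<Longrightarrow> W \<noteq> \<infinity> \<Longrightarrow> recip W = 1 / real_of_ereal W \<and> 0 < real_of_ereal W"
  by (cases W) (auto simp: recip_def zero_ereal_def one_ereal_def)

text \<open>One inequality, valid for every factor, is applied with \<open>c\<close> to
  \<open>g\<close> and with \<open>1 / c\<close> to \<open>c\<close> times \<open>g\<close>.\<close>

lemma esssup_cmult_ennreal:
  fixes g :: "'a \<Rightarrow> ennreal"
  assumes g: "g \<in> borel_measurable M" and c: "0 \<le> c"
  shows "esssup M (\<lambda>x. ennreal c * g x) = ennreal c * esssup M g"
proof -
  have le: "esssup M (\<lambda>x. ennreal b * h x) \<le> ennreal b * esssup M h"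
    if h: "h \<in> borel_measurable M" for b and h :: "'a \<Rightarrow> ennreal"
  proof (rule esssup_I)
    show "(\<lambda>x. ennreal b * h x) \<in> borel_measurable M"
      using h by measurable
    show "AE x in M. ennreal b * h x \<le> ennreal b * esssup M h"
      using esssup_AE[where f = h and M = M] by eventually_elim (intro mult_left_mono, auto)
  qed
  show ?thesis
  proof (cases "c = 0")
    case True
    then show ?thesis
      using le[OF g, of 0] by simp
  next
    case False
    with c have c: "0 < c" by simp
    have canc: "ennreal c * (ennreal (1 / c) * y) = y" "ennreal (1 / c) * (ennreal c * y) = y" for y
      using c by (simp_all add: mult.assoc[symmetric] ennreal_mult[symmetric])
    have "(\<lambda>x. ennreal c * g x) \<in> borel_measurable M"
      using g by measurable
    from le[OF this, of "1 / c"] have "esssup M g \<le> ennreal (1 / c) * esssup M (\<lambda>x. ennreal c * g x)"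
      by (simp add: canc)
    then have "ennreal c * esssup M g \<le> ennreal c * (ennreal (1 / c) * esssup M (\<lambda>x. ennreal c * g x))"
      by (rule mult_left_mono) simp
    then show ?thesis
      using le[OF g, of c] by (simp add: canc)
  qed
qed

lemma esssup_SUP_ennreal:
  fixes G :: "nat \<Rightarrow> 'a \<Rightarrow> ennreal"
  assumes G: "\<And>n. G n \<in> borel_measurable M"
  shows "esssup M (\<lambda>x. SUP n. G n x) = (SUP n. esssup M (G n))"
proof (rule antisym)
  have "AE x in M. \<forall>n. G n x \<le> esssup M (G n)"
    unfolding AE_all_countable by (intro allI esssup_AE)
  then have "AE x in M. (SUP n. G n x) \<le> (SUP n. esssup M (G n))"
    by eventually_elim (intro SUP_mono, auto)
  then show "esssup M (\<lambda>x. SUP n. G n x) \<le> (SUP n. esssup M (G n))"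
    using G by (intro esssup_I) auto
  show "(SUP n. esssup M (G n)) \<le> esssup M (\<lambda>x. SUP n. G n x)"
    by (intro SUP_least esssup_mono G SUP_upper) auto
qed

lemma Lnorm_mono:
  assumes W: "0 < W" and g: "g \<in> borel_measurable (lebesgue_on (einterval a b))"
    and le: "\<And>v. v \<in> einterval a b \<Longrightarrow> g v \<le> h v"
  shows "Lnorm W a b g \<le> Lnorm W a b h"
proof (cases "W = \<infinity>")
  case True
  then show ?thesis
    using g le by (simp add: Lnorm_def) (rule esssup_AE_mono, auto intro!: AE_I2)
next
  case False
  note w = recip_pos[OF W False]
  then show ?thesis
    using False unfolding Lnorm_def
    by (auto intro!: epowr_mono nn_integral_mono le)
qed

lemma Lnorm_mono_set:
  assumes W: "0 < W" and g: "g \<in> borel_measurable (lebesgue_on (einterval a' b'))"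
    and sub: "einterval a b \<subseteq> einterval a' b'"
  shows "Lnorm W a b g \<le> Lnorm W a' b' g"
proof (cases "W = \<infinity>")
  case True
  have "AE x in lebesgue_on (einterval a' b'). g x \<le> esssup (lebesgue_on (einterval a' b')) g"
    by (rule esssup_AE)
  then have "AE x in lebesgue_on (einterval a b). g x \<le> esssup (lebesgue_on (einterval a' b')) g"
    using sub by (simp add: AE_restrict_space_iff) (elim eventually_mono, auto)
  then show ?thesis
    using True measurable_restrict_mono[OF g sub] by (simp add: Lnorm_def esssup_I)
next
  case False
  note w = recip_pos[OF W False]
  then show ?thesis
    using False sub unfolding Lnorm_def
    by (auto simp: nn_integral_restrict_space intro!: epowr_mono nn_integral_mono mult_left_mono split: split_indicator)
qed

lemma Lnorm_cmult:
  assumes W: "0 < W" and g: "g \<in> borel_measurable (lebesgue_on (einterval a b))" and c: "0 \<le> c"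
  shows "Lnorm W a b (\<lambda>v. ennreal c * g v) = ennreal c * Lnorm W a b g"
proof (cases "W = \<infinity>")
  case True
  then show ?thesis
    using esssup_cmult_ennreal[OF g c] by (simp add: Lnorm_def)
next
  case False
  define w where "w = real_of_ereal W"
  have w: "0 < w" "recip W = 1 / w"
    using recip_pos[OF W False] by (simp_all add: w_def)
  have "(\<lambda>v. epowr (g v) w) \<in> borel_measurable (lebesgue_on (einterval a b))"
    using g by measurable
  then have "Lnorm W a b (\<lambda>v. ennreal c * g v)
      = epowr (epowr (ennreal c) w * (\<integral>\<^sup>+ v. epowr (g v) w \<partial>lebesgue_on (einterval a b))) (1 / w)"
    using False w by (simp add: Lnorm_def epowr_mult nn_integral_cmult flip: w_def)
  also have "\<dots> = ennreal c * Lnorm W a b g"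
    using False w by (simp add: Lnorm_def epowr_mult epowr_epowr flip: w_def)
  finally show ?thesis .
qed

lemma Lnorm_SUP:
  assumes W: "0 < W" and G: "\<And>n. G n \<in> borel_measurable (lebesgue_on (einterval a b))"
    and inc: "\<And>v. v \<in> einterval a b \<Longrightarrow> incseq (\<lambda>n. G n v)"
  shows "Lnorm W a b (\<lambda>v. SUP n. G n v) = (SUP n. Lnorm W a b (G n))"
proof (cases "W = \<infinity>")
  case True
  then show ?thesis
    using esssup_SUP_ennreal[OF G] by (simp add: Lnorm_def)
next
  case False
  define w where "w = real_of_ereal W"
  have w: "0 < w" "recip W = 1 / w"
    using recip_pos[OF W False] by (simp_all add: w_def)
  have "(\<integral>\<^sup>+ v. (SUP n. epowr (G n v) w) \<partial>lebesgue_on (einterval a b))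
      = (SUP n. \<integral>\<^sup>+ v. epowr (G n v) w \<partial>lebesgue_on (einterval a b))"
  proof (rule nn_integral_monotone_convergence_SUP_AE)
    show "(\<lambda>v. epowr (G n v) w) \<in> borel_measurable (lebesgue_on (einterval a b))" for n
      using G[of n] by measurable
    show "AE v in lebesgue_on (einterval a b). epowr (G n v) w \<le> epowr (G (Suc n) v) w" for n
      using w inc by (intro AE_I2 epowr_mono) (auto dest: incseq_SucD)
  qed
  then show ?thesis
    using False w by (simp add: Lnorm_def epowr_SUP flip: w_def)
qed

text \<open>The norm of a constant on \<open>(p,q)\<close>. The formula includes
  \<open>W = \<infinity>\<close>: then \<open>recip W\<close> is 0 and the length factor is 1,
  because \<open>p < q\<close>.\<close>

lemma Lnorm_ge_const:
  assumes W: "0 < W" and g: "g \<in> borel_measurable (lebesgue_on (einterval a b))"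
    and pq: "p < q" "{p<..<q} \<subseteq> einterval a b" and le: "\<And>v. p < v \<Longrightarrow> v < q \<Longrightarrow> c \<le> g v"
  shows "c * ennreal ((q - p) powr recip W) \<le> Lnorm W a b g"
proof -
  have em: "emeasure (lebesgue_on {p<..<q}) {p<..<q} = ennreal (q - p)"
    using pq(1) by (simp add: emeasure_restrict_space emeasure_lebesgue_greaterThanLessThan)
  have "Lnorm W (ereal p) (ereal q) (\<lambda>_. c) = c * ennreal ((q - p) powr recip W)"
  proof (cases "W = \<infinity>")
    case True
    then show ?thesis
      using em pq(1) by (simp add: Lnorm_def recip_def esssup_const)
  next
    case False
    define w where "w = real_of_ereal W"
    have w: "0 < w" "recip W = 1 / w"
      using recip_pos[OF W False] by (simp_all add: w_def)
    have "(\<integral>\<^sup>+ v. epowr c w \<partial>lebesgue_on {p<..<q}) = epowr c w * ennreal (q - p)"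
      using em by simp
    then show ?thesis
      using False w pq(1) by (simp add: Lnorm_def epowr_mult epowr_epowr epowr_ennreal flip: w_def)
  qed
  moreover have "Lnorm W (ereal p) (ereal q) (\<lambda>_. c) \<le> Lnorm W (ereal p) (ereal q) g"
    using le by (intro Lnorm_mono W) auto
  moreover have "\<dots> \<le> Lnorm W a b g"
    using pq by (intro Lnorm_mono_set W g) simp
  ultimately show ?thesis
    by simp
qed

text \<open>Raised to a finite power \<open>W\<close>, the factor \<open>v powr (- recip W)\<close>
  becomes the density of \<open>dv / v\<close>, which is invariant under dilations. So the integral
  is \<open>1 / (e * w)\<close> whatever \<open>t\<close> is. For \<open>W = \<infinity>\<close> the
  function is bounded by 1.\<close>

lemma Lnorm_powr_left:
  assumes W: "0 < W" and e: "0 < e"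
  obtains M where "0 < M" "\<And>t. 0 < t \<Longrightarrow>
    Lnorm W 0 (ereal t) (\<lambda>v. ennreal ((v / t) powr e * v powr (- recip W))) \<le> ennreal M"
proof (cases "W = \<infinity>")
  case True
  have "Lnorm W 0 (ereal t) (\<lambda>v. ennreal ((v / t) powr e * v powr (- recip W))) \<le> ennreal 1"
    if "0 < t" for t
    using True e that unfolding Lnorm_def if_P[OF True]
    by (intro esssup_I AE_I2) (measurable, auto simp: recip_def zero_ereal_def powr_le1)
  then show ?thesis
    using that[of 1] by simp
next
  case False
  define w where "w = real_of_ereal W"
  have w: "0 < w" "recip W = 1 / w"
    using recip_pos[OF W False] by (simp_all add: w_def)
  have "Lnorm W 0 (ereal t) (\<lambda>v. ennreal ((v / t) powr e * v powr (- recip W))) \<le> ennreal ((1 / (e * w)) powr (1 / w))"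
    if t: "0 < t" for t
  proof -
    have "(\<integral>\<^sup>+ v. epowr (ennreal ((v / t) powr e * v powr (- recip W))) w \<partial>lebesgue_on (einterval 0 (ereal t)))
       \<le> (\<integral>\<^sup>+ v. ennreal (t powr (- (e * w))) * (ennreal (v powr (e * w - 1)) * indicator {0..t} v) \<partial>lborel)"
      unfolding nn_integral_completion[symmetric, of lborel]
    proof (subst nn_integral_restrict_space, simp, rule nn_integral_mono)
      fix v :: real
      show "epowr (ennreal ((v / t) powr e * v powr (- recip W))) w * indicator (einterval 0 (ereal t)) v
        \<le> ennreal (t powr (- (e * w))) * (ennreal (v powr (e * w - 1)) * indicator {0..t} v)"
      proof (cases "0 < v \<and> v < t")
        case True
        then have "((v / t) powr e * v powr (- recip W)) powr w = t powr (- (e * w)) * v powr (e * w - 1)"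
          using t w by (simp add: powr_mult powr_powr powr_divide powr_minus powr_diff field_simps)
        then have "epowr (ennreal ((v / t) powr e * v powr (- recip W))) w = ennreal (t powr (- (e * w)) * v powr (e * w - 1))"
          by (simp add: epowr_ennreal)
        with True show ?thesis
          by (simp only:) (simp add: zero_ereal_def ennreal_mult)
      qed (auto simp: einterval_iff zero_ereal_def)
    qed
    also have "\<dots> = ennreal (t powr (- (e * w))) * ennreal (t powr (e * w) / (e * w))"
      using nn_integral_has_integral_lebesgue'[OF _ has_integral_powr_from_0[of "e * w - 1" t]] e w t
      by (simp add: nn_integral_cmult)
    also have "\<dots> = ennreal (1 / (e * w))"
      using e w t by (simp add: powr_minus flip: ennreal_mult)
    finally have "epowr (\<integral>\<^sup>+ v. epowr (ennreal ((v / t) powr e * v powr (- recip W))) w \<partial>lebesgue_on (einterval 0 (ereal t))) (1 / w)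
       \<le> epowr (ennreal (1 / (e * w))) (1 / w)"
      using w by (intro epowr_mono) auto
    then show ?thesis
      using False e w by (simp add: Lnorm_def epowr_ennreal flip: w_def)
  qed
  then show ?thesis
    using e w by (intro that[of "(1 / (e * w)) powr (1 / w)"]) simp_all
qed

text \<open>The same invariance, with the negative exponent giving convergence at infinity.
  Enlarging \<open>(t,L)\<close> to the half-line keeps the constant free of
  \<open>L\<close>.\<close>

lemma Lnorm_powr_right:
  assumes W: "0 < W" and e: "0 < e"
  obtains M where "0 < M" "\<And>t. 0 < t \<Longrightarrow>
    Lnorm W (ereal t) L (\<lambda>v. ennreal ((v / t) powr (- e) * v powr (- recip W))) \<le> ennreal M"
proof (cases "W = \<infinity>")
  case True
  have "Lnorm W (ereal t) L (\<lambda>v. ennreal ((v / t) powr (- e) * v powr (- recip W))) \<le> ennreal 1"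
    if t: "0 < t" for t
  proof -
    have "(v / t) powr (- e) \<le> 1" if "t < v" for v
      using that t e powr_mono2'[of "- e" 1 "v / t"] by simp
    then show ?thesis
      using True t unfolding Lnorm_def if_P[OF True]
      by (intro esssup_I AE_I2) (measurable, auto simp: recip_def einterval_iff)
  qed
  then show ?thesis
    using that[of 1] by simp
next
  case False
  define w where "w = real_of_ereal W"
  have w: "0 < w" "recip W = 1 / w"
    using recip_pos[OF W False] by (simp_all add: w_def)
  have "Lnorm W (ereal t) L (\<lambda>v. ennreal ((v / t) powr (- e) * v powr (- recip W))) \<le> ennreal ((1 / (e * w)) powr (1 / w))"
    if t: "0 < t" for t
  proof -
    have "(\<integral>\<^sup>+ v. epowr (ennreal ((v / t) powr (- e) * v powr (- recip W))) w \<partial>lebesgue_on (einterval (ereal t) L))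
       \<le> (\<integral>\<^sup>+ v. ennreal (t powr (e * w)) * (ennreal (v powr (- (e * w) - 1)) * indicator {t..} v) \<partial>lborel)"
      unfolding nn_integral_completion[symmetric, of lborel]
    proof (subst nn_integral_restrict_space, simp, rule nn_integral_mono)
      fix v :: real
      show "epowr (ennreal ((v / t) powr (- e) * v powr (- recip W))) w * indicator (einterval (ereal t) L) v
        \<le> ennreal (t powr (e * w)) * (ennreal (v powr (- (e * w) - 1)) * indicator {t..} v)"
      proof (cases "v \<in> einterval (ereal t) L")
        case True
        then have v: "t < v" "0 < v" using t by (auto simp: einterval_iff)
        then have "((v / t) powr (- e) * v powr (- recip W)) powr w = t powr (e * w) * v powr (- (e * w) - 1)"
          using t w by (simp add: powr_mult powr_powr powr_divide powr_minus powr_diff field_simps)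
        then have "epowr (ennreal ((v / t) powr (- e) * v powr (- recip W))) w = ennreal (t powr (e * w) * v powr (- (e * w) - 1))"
          by (simp add: epowr_ennreal)
        with True v show ?thesis
          by (simp only:) (simp add: ennreal_mult)
      qed auto
    qed
    also have "\<dots> = ennreal (t powr (e * w)) * ennreal (t powr (- (e * w)) / (e * w))"
      using nn_integral_has_integral_lebesgue'[OF _ has_integral_powr_to_inf[of "- (e * w) - 1" t]] e w t
      by (simp add: nn_integral_cmult)
    also have "\<dots> = ennreal (1 / (e * w))"
      using e w t by (simp add: powr_minus flip: ennreal_mult)
    finally have "epowr (\<integral>\<^sup>+ v. epowr (ennreal ((v / t) powr (- e) * v powr (- recip W))) w \<partial>lebesgue_on (einterval (ereal t) L)) (1 / w)
       \<le> epowr (ennreal (1 / (e * w))) (1 / w)"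
      using w by (intro epowr_mono) auto
    then show ?thesis
      using False e w by (simp add: Lnorm_def epowr_ennreal flip: w_def)
  qed
  then show ?thesis
    using e w by (intro that[of "(1 / (e * w)) powr (1 / w)"]) simp_all
qed

text \<open>Common form of \<open>H_left\<close> and \<open>H_right\<close> on functions that are
  already rearranged: the domain is \<open>(0,t)\<close> or \<open>(t,L)\<close>, and
  \<open>\<alpha>\<close> is \<open>recip U\<close> or \<open>recip V\<close>. Since the domain
  grows or shrinks with \<open>t\<close>, the norm over it is monotone in \<open>t\<close> and
  therefore measurable. No assumption mentions \<open>\<alpha>\<close>, so it is an argument of
  \<open>averaging.avg\<close> but not of the predicate \<open>averaging\<close>.\<close>

locale averaging =
  fixes L W :: ereal and \<alpha> :: real and d :: "real \<Rightarrow> real" and a b :: "real \<Rightarrow> ereal"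
  assumes W_pos: "0 < W"
    and d_measurable: "d \<in> borel_measurable (leb L)"
    and d_pos: "t \<in> einterval 0 L \<Longrightarrow> 0 < d t"
    and dom_subset: "t \<in> einterval 0 L \<Longrightarrow> einterval (a t) (b t) \<subseteq> einterval 0 L"
    and dom_monotone: "mono_on (einterval 0 L) (\<lambda>t. einterval (a t) (b t)) \<or>
      antimono_on (einterval 0 L) (\<lambda>t. einterval (a t) (b t))"
begin

abbreviation integrand :: "(real \<Rightarrow> ennreal) \<Rightarrow> real \<Rightarrow> ennreal" where
  "integrand h v \<equiv> ennreal (v powr (\<alpha> - recip W) * d v) * h v"

definition avg :: "(real \<Rightarrow> ennreal) \<Rightarrow> real \<Rightarrow> ennreal" where
  "avg h t = inverse (ennreal (t powr \<alpha> * d t)) * Lnorm W (a t) (b t) (integrand h)"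

lemma integrand_measurable:
  assumes "antimono_on (einterval 0 L) h" "t \<in> einterval 0 L"
  shows "integrand h \<in> borel_measurable (lebesgue_on (einterval (a t) (b t)))"
proof (rule measurable_restrict_mono[OF _ dom_subset[OF assms(2)]])
  show "integrand h \<in> borel_measurable (leb L)"
    using borel_measurable_antimono_on[OF assms(1)] d_measurable by measurable
qed

lemma avg_measurable:
  assumes h: "antimono_on (einterval 0 L) h"
  shows "avg h \<in> borel_measurable (leb L)"
proof -
  let ?l = "\<lambda>t. Lnorm W (a t) (b t) (integrand h)"
  have "?l \<in> borel_measurable (leb L)"
    using dom_monotone
  proof
    assume m: "mono_on (einterval 0 L) (\<lambda>t. einterval (a t) (b t))"
    show ?thesis
    proof (intro borel_measurable_monotone_on disjI1 monotone_onI)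
      fix s t assume st: "s \<in> einterval 0 L" "t \<in> einterval 0 L" "s \<le> t"
      show "?l s \<le> ?l t"
        using st by (intro Lnorm_mono_set W_pos integrand_measurable h) (auto dest: mono_onD[OF m])
    qed
  next
    assume m: "antimono_on (einterval 0 L) (\<lambda>t. einterval (a t) (b t))"
    show ?thesis
    proof (intro borel_measurable_antimono_on monotone_onI)
      fix s t assume st: "s \<in> einterval 0 L" "t \<in> einterval 0 L" "s \<le> t"
      show "?l t \<le> ?l s"
        using st m by (intro Lnorm_mono_set W_pos integrand_measurable h) (auto simp: monotone_on_def)
    qed
  qed
  then show ?thesis
    unfolding avg_def using d_measurable by measurable
qed

lemma avg_mono:
  assumes g: "antimono_on (einterval 0 L) g"
    and le: "\<And>x. x \<in> einterval 0 L \<Longrightarrow> g x \<le> h x" and t: "t \<in> einterval 0 L"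
  shows "avg g t \<le> avg h t"
  unfolding avg_def
  using dom_subset[OF t] le
  by (intro mult_left_mono Lnorm_mono W_pos integrand_measurable g t) auto

lemma avg_cmult:
  assumes h: "antimono_on (einterval 0 L) h" and c: "0 \<le> c" and t: "t \<in> einterval 0 L"
  shows "avg (\<lambda>x. ennreal c * h x) t = ennreal c * avg h t"
  unfolding avg_def using Lnorm_cmult[OF W_pos integrand_measurable[OF h t] c]
  by (simp add: ac_simps)

lemma avg_SUP:
  assumes G: "\<And>n. antimono_on (einterval 0 L) (G n)"
    and inc: "\<And>x. x \<in> einterval 0 L \<Longrightarrow> incseq (\<lambda>n. G n x)" and t: "t \<in> einterval 0 L"
  shows "avg (\<lambda>x. SUP n. G n x) t = (SUP n. avg (G n) t)"
proof -
  have "Lnorm W (a t) (b t) (\<lambda>v. SUP n. integrand (G n) v) = (SUP n. Lnorm W (a t) (b t) (integrand (G n)))"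
  proof (rule Lnorm_SUP[OF W_pos integrand_measurable[OF G t]])
    fix v assume "v \<in> einterval (a t) (b t)"
    then have "incseq (\<lambda>n. G n v)"
      using inc dom_subset[OF t] by blast
    then show "incseq (\<lambda>n. integrand (G n) v)"
      unfolding incseq_def by (auto intro: mult_left_mono)
  qed
  then show ?thesis
    by (simp add: avg_def SUP_mult_left_ennreal)
qed

end

section \<open>Pointwise bounds\<close>

text \<open>The almost increasing function \<open>t powr e * d t\<close> bounds \<open>d\<close> at
  the smaller point by \<open>d\<close> at the larger one, the almost decreasing function does the
  converse. Both directions matter: the two operators look to opposite sides of \<open>t\<close>,
  and upper and lower bounds compare \<open>d\<close> in opposite directions.\<close>

lemma SV_growth:
  assumes SV: "SV L d" and e: "0 < e"
  shows "\<exists>K>0. \<forall>s\<in>einterval 0 L. \<forall>t\<in>einterval 0 L. s \<le> t \<longrightarrow>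
    d s \<le> K * (t / s) powr e * d t \<and> d t \<le> K * (t / s) powr e * d s"
proof -
  have pos: "0 < d t" if "t \<in> einterval 0 L" for t
    using SV that unfolding SV_def by blast
  have "\<forall>e > 0. (\<exists>g c C. 0 < c \<and> 0 < C \<and> mono_on (einterval 0 L) g \<and>
           (\<forall>t \<in> einterval 0 L. c * g t \<le> t powr e * d t \<and> t powr e * d t \<le> C * g t)) \<and>
        (\<exists>g c C. 0 < c \<and> 0 < C \<and> antimono_on (einterval 0 L) g \<and>
           (\<forall>t \<in> einterval 0 L. c * g t \<le> t powr (- e) * d t \<and> t powr (- e) * d t \<le> C * g t))"
    using SV unfolding SV_def by (elim conjE)
  note * = this[rule_format, OF e]
  obtain g c C where g: "0 < c" "0 < C" "mono_on (einterval 0 L) g"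
    "\<And>t. t \<in> einterval 0 L \<Longrightarrow> c * g t \<le> t powr e * d t \<and> t powr e * d t \<le> C * g t"
    using conjunct1[OF *] by (elim exE conjE) blast
  obtain g' c' C' where g': "0 < c'" "0 < C'" "antimono_on (einterval 0 L) g'"
    "\<And>t. t \<in> einterval 0 L \<Longrightarrow> c' * g' t \<le> t powr (- e) * d t \<and> t powr (- e) * d t \<le> C' * g' t"
    using conjunct2[OF *] by (elim exE conjE) blast
  define K where "K = max (C / c) (C' / c')"
  have K: "0 < K" "C / c \<le> K" "C' / c' \<le> K"
    using g(1,2) by (auto simp: K_def less_max_iff_disj)
  show ?thesis
  proof (intro exI[of _ K] conjI[OF K(1)] ballI impI)
    fix s t assume st: "s \<in> einterval 0 L" "t \<in> einterval 0 L" "s \<le> t"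
    then have s0: "0 < s" "0 < t"
      by (auto simp: einterval_iff zero_ereal_def)
    have "s powr e * d s \<le> C * g s"
      using g(4)[OF st(1)] by blast
    also have "\<dots> \<le> C * g t"
      using g(2,3) st by (intro mult_left_mono) (auto dest: mono_onD)
    also have "\<dots> \<le> C / c * (t powr e * d t)"
      using g(1,2) g(4)[OF st(2)] by (simp add: field_simps)
    also have "\<dots> \<le> K * (t powr e * d t)"
      using K(2) pos[OF st(2)] by (intro mult_right_mono) auto
    finally have 1: "d s \<le> K * (t / s) powr e * d t"
      using s0 by (simp add: powr_divide field_simps)
    have "t powr (- e) * d t \<le> C' * g' t"
      using g'(4)[OF st(2)] by blast
    also have "\<dots> \<le> C' * g' s"
      using g'(2,3) st by (intro mult_left_mono) (auto simp: monotone_on_def)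
    also have "\<dots> \<le> C' / c' * (s powr (- e) * d s)"
      using g'(1,2) g'(4)[OF st(1)] by (simp add: field_simps)
    also have "\<dots> \<le> K * (s powr (- e) * d s)"
      using K(3) pos[OF st(1)] by (intro mult_right_mono) auto
    finally have "d t \<le> K * (t / s) powr e * d s"
      using s0 by (simp add: powr_divide powr_minus field_simps)
    with 1 show "d s \<le> K * (t / s) powr e * d t \<and> d t \<le> K * (t / s) powr e * d s" ..
  qed
qed

lemma geometric_bracket:
  assumes b: "1 < (b::real)" and x: "1 \<le> x"
  obtains k :: nat where "b powr real k \<le> x" "x < b powr (real k + 1)"
proof
  let ?k = "nat \<lfloor>log b x\<rfloor>"
  have "0 \<le> log b x"
    using b x by simp
  then have k: "real ?k = of_int \<lfloor>log b x\<rfloor>"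
    by simp
  show "b powr real ?k \<le> x"
    using b x of_int_floor_le[of "log b x"] by (simp only: k) (simp add: powr_le_iff)
  show "x < b powr (real ?k + 1)"
    using b x floor_correct[of "log b x"] by (simp only: k) (simp add: less_powr_iff)
qed

text \<open>Of two consecutive dyadic blocks one misses \<open>A\<close>. The two blocks preceding
  the one that contains \<open>s\<close> are used: the missed one is \<open>[c, 2 * c)\<close> with
  \<open>2 * c \<le> s \<le> 8 * c\<close>, so at least an eighth of \<open>(0,s)\<close> lies
  outside \<open>A\<close>. The shift \<open>j\<close> treats the even and the odd blocks at
  once.\<close>

lemma parity_log_density:
  fixes j :: int
  defines "A \<equiv> {x. even (\<lfloor>log 2 x\<rfloor> + j)}"
  assumes s: "0 < s"
  shows "emeasure lebesgue (A \<inter> {0<..<s}) \<le> ennreal (7 / 8 * s)"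
proof -
  define m where "m = \<lfloor>log 2 s\<rfloor>"
  have m: "2 powr m \<le> s" "s < 2 powr (m + 1)"
    using s floor_correct[of "log 2 s"] by (simp_all add: m_def powr_le_iff less_powr_iff)
  obtain i :: int where i: "i = 1 \<or> i = 2" "odd (m - i + j)"
  proof (cases "even (m + j)")
    case True
    then show ?thesis by (intro that[of 1]) auto
  next
    case False
    then show ?thesis by (intro that[of 2]) auto
  qed
  define c :: real where "c = 2 powr (m - i)"
  have c2: "2 * c = 2 powr (m - i + 1)"
    by (simp add: c_def powr_add)
  have "s \<le> 8 * c"
  proof -
    have "2 powr (m + 1) = 4 * 2 powr (m - 1 :: real)" "2 powr (m + 1) = 8 * 2 powr (m - 2 :: real)"
      by (simp_all add: powr_diff powr_add)
    then have "s < 4 * c \<or> s < 8 * c"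
      using m(2) i(1) by (auto simp: c_def)
    moreover have "0 < c"
      by (simp add: c_def)
    ultimately show ?thesis
      by linarith
  qed
  have "2 * c \<le> s"
  proof -
    have "2 powr (m - i + 1) \<le> (2::real) powr m"
      using i(1) by auto
    from order_trans[OF this m(1)] show ?thesis
      by (simp only: c2)
  qed
  have "A \<inter> {0<..<s} \<subseteq> {0<..<c} \<union> ({2 * c} \<union> {2 * c<..<s})"
  proof
    fix x assume x: "x \<in> A \<inter> {0<..<s}"
    have False if "c \<le> x" "x < 2 * c"
    proof -
      have "0 < x" using x by simp
      then have "real_of_int (m - i) \<le> log 2 x" "log 2 x < real_of_int (m - i) + 1"
        using that unfolding c2 unfolding c_def by (simp_all add: le_log_iff log_less_iff)
      then have "\<lfloor>log 2 x\<rfloor> = m - i"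
        by linarith
      with x i(2) show False
        by (simp add: A_def)
    qed
    with x show "x \<in> {0<..<c} \<union> ({2 * c} \<union> {2 * c<..<s})"
      by force
  qed
  then have "emeasure lebesgue (A \<inter> {0<..<s}) \<le> emeasure lebesgue ({0<..<c} \<union> ({2 * c} \<union> {2 * c<..<s}))"
    by (intro emeasure_mono) auto
  also have "\<dots> \<le> emeasure lebesgue {0<..<c} + (emeasure lebesgue {2 * c} + emeasure lebesgue {2 * c<..<s})"
    by (intro order_trans[OF emeasure_subadditive] add_mono emeasure_subadditive order_refl) auto
  also have "\<dots> = ennreal c + ennreal (s - 2 * c)"
    by (simp add: emeasure_lebesgue_greaterThanLessThan) (simp add: emeasure_completion)
  also have "\<dots> = ennreal (s - c)"
    using \<open>2 * c \<le> s\<close> by (subst ennreal_plus[symmetric]) (simp_all add: c_def)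
  also have "\<dots> \<le> ennreal (7 / 8 * s)"
    using \<open>s \<le> 8 * c\<close> by (intro ennreal_leI) simp
  finally show ?thesis .
qed

text \<open>If the dilated value at \<open>t\<close> is at most \<open>l\<close>, points of the
  superlevel set lie in \<open>A\<close> and below \<open>8 / 7 * t\<close>. Their measure is then
  at most \<open>7 / 8\<close> of that, which is exactly \<open>t\<close>. This also covers the case
  that \<open>8 / 7 * t\<close> lies outside the interval.\<close>

lemma rearr_indicator_dilation:
  assumes h: "rcdecr L h" and A: "A \<in> sets lebesgue"
    and dens: "\<And>s. 0 < s \<Longrightarrow> emeasure lebesgue (A \<inter> {0<..<s}) \<le> ennreal (7 / 8 * s)"
    and t: "t \<in> einterval 0 L"
  shows "rearr L (\<lambda>x. h x * indicator A x) t \<le> edil L (8 / 7) h t"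
proof (rule ennreal_le_by_levels, rule ccontr)
  let ?u = "\<lambda>x. h x * indicator A x"
  fix l :: real assume l: "0 \<le> l" and *: "ennreal l < rearr L ?u t" and n: "\<not> ennreal l < edil L (8 / 7) h t"
  have t0: "0 < t"
    using t by (simp add: einterval_iff zero_ereal_def)
  have "indicator A \<in> borel_measurable (leb L)"
    using A by (intro measurable_restrict_space1 borel_measurable_indicator)
  then have "?u \<in> borel_measurable (leb L)"
    using rcdecr_measurable[OF h] by measurable
  with * l have "ennreal t < emeasure lebesgue {x \<in> einterval 0 L. ennreal l < ?u x}"
    by (simp add: rearr_gt_iff)
  also have "\<dots> \<le> emeasure lebesgue (A \<inter> {0<..<8 / 7 * t})"
  proof (intro emeasure_mono subsetI)
    fix x assume x: "x \<in> {x \<in> einterval 0 L. ennreal l < ?u x}"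
    then have xA: "x \<in> A" and xI: "x \<in> einterval 0 L" and lx: "ennreal l < h x"
      by (auto split: split_indicator_asm)
    have "x < 8 / 7 * t"
    proof (rule ccontr)
      assume "\<not> x < 8 / 7 * t"
      then have le: "8 / 7 * t \<le> x" by simp
      then have I: "8 / 7 * t \<in> einterval 0 L"
        using mult_in_einterval0[OF xI] t0 by simp
      have "h x \<le> h (8 / 7 * t)"
        by (rule rcdecr_mono[OF h I xI le])
      then have "ennreal l < h (8 / 7 * t)"
        using lx by simp
      then show False
        using n I by (simp add: edil_def)
    qed
    with xA xI show "x \<in> A \<inter> {0<..<8 / 7 * t}"
      by (simp add: einterval_iff zero_ereal_def)
  qed (use A in auto)
  also have "\<dots> \<le> ennreal (7 / 8 * (8 / 7 * t))"
    using t0 by (intro dens) simp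
  finally show False
    by simp
qed

context ri_qnorm
begin

lemma rearr_B_norm: "rcdecr L h \<Longrightarrow> EN h = B_norm L \<rho> h"
  by (intro B_norm_cong rearr_measurable rcdecr_measurable rearr_rcdecr)

text \<open>Boundedness of a dilation that stretches functions: \<open>h\<close> is split into its restrictions to the set
  of all \<open>x\<close> with \<open>\<lfloor>log\<^sub>2 x\<rfloor>\<close> even and to the complement. Each of the two sets fills at most
  \<open>7/8\<close> of every interval \<open>(0,s)\<close>, so that the rearrangements of both parts lie below the dilation of \<open>h\<close>.\<close>

lemma B_norm_le_edil:
  obtains K where "0 < K" "\<And>h. rcdecr L h \<Longrightarrow> B_norm L \<rho> h \<le> ennreal K * B_norm L \<rho> (edil L (8 / 7) h)"
proof -
  obtain C where C: "1 \<le> C"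
    "\<And>f g. f \<in> Mplus L \<Longrightarrow> g \<in> Mplus L \<Longrightarrow> EN (\<lambda>x. f x + g x) \<le> ennreal C * (EN f + EN g)"
    using EN_add by metis
  have "B_norm L \<rho> h \<le> ennreal (2 * C) * B_norm L \<rho> (edil L (8 / 7) h)" if h: "rcdecr L h" for h
  proof (cases "B_norm L \<rho> (edil L (8 / 7) h) < \<infinity>")
    case True
    let ?e = "edil L (8 / 7) h"
    have e: "rcdecr L ?e"
      by (rule rcdecr_edil[OF h]) simp
    \<comment> \<open>The dilation at \<open>7 / 8 * x\<close> has the value \<open>h x\<close>, so
      finiteness of its norm makes \<open>h\<close> finite everywhere and puts the two pieces into
      \<open>Mplus\<close>.\<close>
    have h_fin: "h x < \<infinity>" if x: "x \<in> einterval 0 L" for x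
    proof -
      have "7 / 8 * x \<in> einterval 0 L"
        using mult_in_einterval0[OF x, of "7 / 8 * x"] x by (simp add: einterval_iff zero_ereal_def)
      then have "?e (7 / 8 * x) < \<infinity>"
        using B_norm_finiteD[OF True] by (intro rcdecr_AE_less_top[OF e]) auto
      then show ?thesis
        using x by (simp add: edil_def)
    qed
    define A :: "int \<Rightarrow> real set" where "A j = {x. even (\<lfloor>log 2 x\<rfloor> + j)}" for j
    define u where "u j x = h x * indicator (A j) x" for j x
    have A: "A j \<in> sets lebesgue" for j
    proof -
      have "{x \<in> space borel. even (\<lfloor>log 2 x\<rfloor> + j)} \<in> sets borel"
        by measurable
      then show ?thesis by (simp add: A_def)
    qed
    have uM: "u j \<in> Mplus L" for j
    proof -
      have "indicator (A j) \<in> borel_measurable (leb L)"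
        using A by (intro measurable_restrict_space1 borel_measurable_indicator)
      then have "u j \<in> borel_measurable (leb L)"
        unfolding u_def using rcdecr_measurable[OF h] by measurable
      moreover have "AE x in leb L. u j x < \<infinity>"
        by (rule AE_leb_I, drule h_fin) (simp add: u_def indicator_def)
      ultimately show ?thesis
        by (simp add: Mplus_def)
    qed
    have uE: "EN (u j) \<le> B_norm L \<rho> ?e" for j
      unfolding u_def
      by (intro B_norm_mono rcdecr_measurable e rearr_measurable AE_leb_I rearr_indicator_dilation h A)
        (unfold A_def, rule parity_log_density)
    have "B_norm L \<rho> h = EN (\<lambda>x. u 0 x + u 1 x)"
    proof -
      have "h = (\<lambda>x. u 0 x + u 1 x)"
        by (auto simp: fun_eq_iff u_def A_def indicator_def)
      then show ?thesis
        using rearr_B_norm[OF h] by simp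
    qed
    also have "\<dots> \<le> ennreal C * (EN (u 0) + EN (u 1))"
      by (intro C uM)
    also have "\<dots> \<le> ennreal C * (B_norm L \<rho> ?e + B_norm L \<rho> ?e)"
      by (intro mult_left_mono add_mono uE) simp
    also have "\<dots> = ennreal (2 * C) * B_norm L \<rho> ?e"
      using C(1) by (simp add: ennreal_mult mult.assoc mult.left_commute flip: mult_2)
    finally show ?thesis .
  next
    case False
    then have "B_norm L \<rho> (edil L (8 / 7) h) = top"
      by (simp add: less_top[symmetric])
    then show ?thesis
      using C(1) by (simp add: ennreal_mult_top)
  qed
  then show ?thesis
    using C(1) by (intro that[of "2 * C"]) auto
qed

text \<open>The last hypothesis is the balance of three effects: growth of
  \<open>Crho ^ Suc k\<close>, the weights, and the real majorants \<open>\<delta>\<close> of the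
  dilation norms. What remains is a geometric series with sum 2.\<close>

lemma B_norm_dilation_series:
  assumes h: "rcdecr L h" and fin: "B_norm L \<rho> h < \<infinity>" and a: "\<And>k. 0 < a k"
    and w: "\<And>k. 0 \<le> w k" and del: "\<And>k. 0 \<le> \<delta> k" "\<And>k. dil_norm L \<rho> (a k) \<le> ennreal (\<delta> k)"
    and M: "0 \<le> M" "\<And>k. Crho ^ Suc k * (w k * \<delta> k) \<le> M * (1 / 2) ^ k"
  shows "B_norm L \<rho> (\<lambda>t. \<Sum>k. ennreal (w k) * edil L (a k) h t) \<le> ennreal (2 * M) * B_norm L \<rho> h"
proof -
  have em: "edil L (a k) h \<in> borel_measurable (leb L)" for k
    by (intro rcdecr_measurable rcdecr_edil h a)
  have C: "0 \<le> Crho ^ Suc k" for k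
    using Crho(1) by simp
  have "B_norm L \<rho> (\<lambda>t. \<Sum>k. ennreal (w k) * edil L (a k) h t)
      \<le> (\<Sum>k. ennreal (Crho ^ Suc k) * B_norm L \<rho> (\<lambda>t. ennreal (w k) * edil L (a k) h t))"
    using em by (intro B_norm_suminf) measurable
  also have "\<dots> \<le> (\<Sum>k. ennreal (M * (1 / 2) ^ k) * B_norm L \<rho> h)"
  proof (intro suminf_le summableI)
    fix k
    have "ennreal (Crho ^ Suc k) * B_norm L \<rho> (\<lambda>t. ennreal (w k) * edil L (a k) h t)
        = ennreal (Crho ^ Suc k) * (ennreal (w k) * B_norm L \<rho> (edil L (a k) h))"
      by (simp only: B_norm_cmult[OF em w])
    also have "\<dots> \<le> ennreal (Crho ^ Suc k) * (ennreal (w k) * (ennreal (\<delta> k) * B_norm L \<rho> h))"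
      by (intro mult_left_mono order_trans[OF B_norm_edil[OF h fin a]] mult_right_mono del) auto
    also have "\<dots> = ennreal (Crho ^ Suc k * (w k * \<delta> k)) * B_norm L \<rho> h"
      using C w del(1) by (simp only: ennreal_mult mult_nonneg_nonneg mult.assoc)
    also have "\<dots> \<le> ennreal (M * (1 / 2) ^ k) * B_norm L \<rho> h"
      by (intro mult_right_mono ennreal_leI M) simp
    finally show "ennreal (Crho ^ Suc k) * B_norm L \<rho> (\<lambda>t. ennreal (w k) * edil L (a k) h t)
        \<le> ennreal (M * (1 / 2) ^ k) * B_norm L \<rho> h" .
  qed
  also have "\<dots> = (\<Sum>k. ennreal (M * (1 / 2) ^ k)) * B_norm L \<rho> h"
    by simp
  also have "(\<Sum>k. ennreal (M * (1 / 2) ^ k)) = ennreal (2 * M)"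
  proof (rule suminf_ennreal_eq)
    show "(\<lambda>k. M * (1 / 2) ^ k) sums (2 * M)"
      using sums_mult[OF geometric_sums[of "1 / 2 :: real"], of M] by (simp add: mult.commute)
  qed (use M(1) in simp)
  finally show ?thesis .
qed

end

section \<open>Upper and lower bounds for an average at a fixed point\<close>

context averaging
begin

text \<open>\<open>exps\<close> distributes the powers of \<open>v / t\<close>: \<open>e\<close> is
  the loss from \<open>d\<close>, \<open>e'\<close> goes into the dilation-invariant norm bounded by
  \<open>M\<close>, and \<open>\<beta>\<close> is left for \<open>h\<close>. With \<open>t\<close>
  fixed, \<open>S\<close> is a constant and leaves the norm.\<close>

lemma avg_le:
  assumes t: "t \<in> einterval 0 L" and KM: "0 < K" "0 < M"
    and norm: "Lnorm W (a t) (b t) (\<lambda>v. ennreal ((v / t) powr e' * v powr (- recip W))) \<le> ennreal M"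
    and exps: "\<alpha> + e = e' + \<beta>"
    and dv: "\<And>v. v \<in> einterval (a t) (b t) \<Longrightarrow> d v \<le> K * (v / t) powr e * d t"
    and bd: "\<And>v. v \<in> einterval (a t) (b t) \<Longrightarrow> \<exists>w. (v / t) powr \<beta> \<le> w \<and> ennreal w * h v \<le> S"
    and h: "antimono_on (einterval 0 L) h"
  shows "avg h t \<le> ennreal (K * M) * S"
proof (cases S rule: ennreal_cases)
  case top
  then show ?thesis
    using KM by (simp add: ennreal_mult_top)
next
  case (real s)
  have t0: "0 < t"
    using t by (simp add: einterval_iff zero_ereal_def)
  define D where "D = t powr \<alpha> * d t"
  have D0: "0 < D"
    using t0 d_pos[OF t] by (simp add: D_def)
  have "integrand h v \<le> ennreal (K * D * s) * ennreal ((v / t) powr e' * v powr (- recip W))"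
    if v: "v \<in> einterval (a t) (b t)" for v
  proof -
    obtain w where w: "(v / t) powr \<beta> \<le> w" "ennreal w * h v \<le> S"
      using bd[OF v] by blast
    have "v \<in> einterval 0 L"
      using dom_subset[OF t] v by blast
    then have v0: "0 < v"
      by (simp add: einterval_iff zero_ereal_def)
    define y where "y = (v / t) powr e' * v powr (- recip W)"
    have y0: "0 \<le> y"
      by (simp add: y_def)
    have w0: "0 \<le> w"
      using w(1) powr_ge_zero[of "v / t" \<beta>] by linarith
    have "v powr (\<alpha> - recip W) * d v \<le> v powr (\<alpha> - recip W) * (K * (v / t) powr e * d t)"
      by (intro mult_left_mono dv v) simp
    also have "\<dots> = K * D * y * (v / t) powr \<beta>"
    proof -
      have "v powr (\<alpha> - recip W) = v powr \<alpha> * v powr (- recip W)"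
        by (simp flip: powr_add)
      moreover have "v powr \<alpha> = t powr \<alpha> * (v / t) powr \<alpha>"
        using v0 t0 by (simp add: powr_divide)
      moreover have "(v / t) powr \<alpha> * (v / t) powr e = (v / t) powr e' * (v / t) powr \<beta>"
        by (simp add: exps flip: powr_add)
      ultimately show ?thesis
        by (simp add: D_def y_def ac_simps)
    qed
    also have "\<dots> \<le> K * D * y * w"
      using KM D0 y0 by (intro mult_left_mono w) auto
    finally have "integrand h v \<le> ennreal (K * D * y * w) * h v"
      by (intro mult_right_mono ennreal_leI) auto
    also have "\<dots> = ennreal (K * D * y) * (ennreal w * h v)"
      using KM D0 w0 y0 by (subst ennreal_mult) (simp_all add: mult.assoc)
    also have "\<dots> \<le> ennreal (K * D * y) * ennreal s"
      using w(2) real by (intro mult_left_mono) simp_all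
    also have "\<dots> = ennreal (K * D * s) * ennreal y"
      using KM D0 real(1) y0 by (simp add: ac_simps flip: ennreal_mult)
    finally show ?thesis
      by (simp add: y_def)
  qed
  then have "Lnorm W (a t) (b t) (integrand h)
      \<le> Lnorm W (a t) (b t) (\<lambda>v. ennreal (K * D * s) * ennreal ((v / t) powr e' * v powr (- recip W)))"
    by (intro Lnorm_mono W_pos integrand_measurable h t)
  also have "\<dots> = ennreal (K * D * s) * Lnorm W (a t) (b t) (\<lambda>v. ennreal ((v / t) powr e' * v powr (- recip W)))"
    using KM D0 real(1) by (intro Lnorm_cmult W_pos) (measurable, auto)
  also have "\<dots> \<le> ennreal (K * D * s) * ennreal M"
    by (intro mult_left_mono norm) simp
  finally have "avg h t \<le> inverse (ennreal D) * (ennreal (K * D * s) * ennreal M)"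
    unfolding avg_def D_def[symmetric] by (rule mult_left_mono) simp
  also have "\<dots> = ennreal (inverse D * (K * D * s * M))"
    using KM D0 real(1) by (simp add: inverse_ennreal flip: ennreal_mult)
  also have "inverse D * (K * D * s * M) = K * M * s"
    using D0 by (simp add: field_simps)
  also have "ennreal (K * M * s) = ennreal (K * M) * S"
    using KM real by (simp add: ennreal_mult)
  finally show ?thesis .
qed

text \<open>The average is restricted to \<open>(p,q)\<close>. There
  \<open>v powr (- recip W)\<close> is at least \<open>(2 * t) powr (- recip W)\<close>, while the
  length contributes at least \<open>(t / 7) powr recip W\<close>; the ratio of \<open>2 * t\<close>
  to \<open>t / 7\<close> is the 14 in the constant.\<close>

lemma le_avg:
  assumes t: "t \<in> einterval 0 L" and pos: "0 < K" "0 < \<kappa>" "0 \<le> recip W"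
    and pq: "0 \<le> p" "p + t / 7 \<le> q" "q \<le> 2 * t" "{p<..<q} \<subseteq> einterval (a t) (b t)"
    and v: "\<And>v. p < v \<Longrightarrow> v < q \<Longrightarrow> y \<le> h v \<and> d t \<le> K * d v \<and> \<kappa> * t powr \<alpha> \<le> v powr \<alpha>"
    and h: "antimono_on (einterval 0 L) h"
  shows "y \<le> ennreal (K / \<kappa> * 14 powr recip W) * avg h t"
proof -
  let ?r = "recip W"
  have t0: "0 < t"
    using t by (simp add: einterval_iff zero_ereal_def)
  have dt: "0 < d t"
    by (rule d_pos[OF t])
  define D where "D = t powr \<alpha> * d t"
  have D0: "0 < D"
    using t0 dt by (simp add: D_def)
  define c where "c = \<kappa> * D * (2 * t) powr (- ?r) / K"
  have c0: "0 < c"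
    using pos D0 t0 by (simp add: c_def)
  have "ennreal c * y \<le> integrand h x" if x: "p < x" "x < q" for x
  proof -
    have x0: "0 < x" using x pq by simp
    have "(2 * t) powr (- ?r) \<le> x powr (- ?r)"
      using x pq x0 pos by (intro powr_mono2') auto
    moreover have "\<kappa> * t powr \<alpha> \<le> x powr \<alpha>" "d t / K \<le> d x"
      using v[OF x] pos by (auto simp: field_simps)
    ultimately have "\<kappa> * t powr \<alpha> * (2 * t) powr (- ?r) * (d t / K) \<le> x powr \<alpha> * x powr (- ?r) * d x"
      using pos dt by (intro mult_mono) auto
    then have "c \<le> x powr (\<alpha> - ?r) * d x"
      by (simp add: c_def D_def ac_simps flip: powr_add)
    then show ?thesis
      using v[OF x] by (intro mult_mono ennreal_leI) auto
  qed
  then have "ennreal c * y * ennreal ((q - p) powr ?r) \<le> Lnorm W (a t) (b t) (integrand h)"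
    using pq t0 by (intro Lnorm_ge_const W_pos integrand_measurable h t) auto
  then have "inverse (ennreal D) * (ennreal c * y * ennreal ((q - p) powr ?r)) \<le> avg h t"
    unfolding avg_def D_def by (rule mult_left_mono) simp
  moreover have "ennreal (\<kappa> / K * (1 / 14) powr ?r) \<le> inverse (ennreal D) * (ennreal c * ennreal ((q - p) powr ?r))"
  proof -
    have "(1 / 14) powr ?r = (2 * t) powr (- ?r) * (t / 7) powr ?r"
      using t0 by (simp add: powr_minus powr_divide powr_mult field_simps flip: powr_mult)
    also have "\<dots> \<le> (2 * t) powr (- ?r) * (q - p) powr ?r"
      using pq t0 pos by (intro mult_left_mono powr_mono2) auto
    finally have "\<kappa> / K * (1 / 14) powr ?r \<le> \<kappa> / K * ((2 * t) powr (- ?r) * (q - p) powr ?r)"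
      using pos by (intro mult_left_mono) auto
    also have "\<dots> = inverse D * (c * (q - p) powr ?r)"
      using D0 pos by (simp add: c_def field_simps)
    finally have "ennreal (\<kappa> / K * (1 / 14) powr ?r) \<le> ennreal (inverse D * (c * (q - p) powr ?r))"
      by (rule ennreal_leI)
    then show ?thesis
      using D0 c0 by (simp add: inverse_ennreal ennreal_mult)
  qed
  then have "ennreal (\<kappa> / K * (1 / 14) powr ?r) * y \<le> inverse (ennreal D) * (ennreal c * ennreal ((q - p) powr ?r)) * y"
    by (rule mult_right_mono) simp
  ultimately have "ennreal (\<kappa> / K * (1 / 14) powr ?r) * y \<le> avg h t"
    by (simp add: ac_simps)
  then have "ennreal (K / \<kappa> * 14 powr ?r) * (ennreal (\<kappa> / K * (1 / 14) powr ?r) * y)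
      \<le> ennreal (K / \<kappa> * 14 powr ?r) * avg h t"
    by (rule mult_left_mono) simp
  moreover have "K / \<kappa> * 14 powr ?r * (\<kappa> / K * (1 / 14) powr ?r) = 1"
    using pos by (simp add: powr_divide)
  then have "ennreal (K / \<kappa> * 14 powr ?r) * (ennreal (\<kappa> / K * (1 / 14) powr ?r) * y) = y"
    using pos by (simp add: mult.assoc[symmetric] flip: ennreal_mult)
  ultimately show ?thesis
    by simp
qed

end

lemma averaging_left:
  assumes "0 < W" "SV L d"
  shows "averaging L W d (\<lambda>_. 0) ereal"
proof
  show "0 < W" "d \<in> borel_measurable (leb L)" "\<And>t. t \<in> einterval 0 L \<Longrightarrow> 0 < d t"
    using assms by (simp_all add: SV_def)
  show "einterval 0 (ereal t) \<subseteq> einterval 0 L" if "t \<in> einterval 0 L" for t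
    using mult_in_einterval0[OF that] by (auto simp: einterval_iff zero_ereal_def)
  show "mono_on (einterval 0 L) (\<lambda>t. einterval 0 (ereal t)) \<or> antimono_on (einterval 0 L) (\<lambda>t. einterval 0 (ereal t))"
    by (rule disjI1, rule monotone_onI) (auto simp: einterval_iff)
qed

lemma averaging_right: "0 < W \<Longrightarrow> SV L d \<Longrightarrow> averaging L W d ereal (\<lambda>_. L)"
  unfolding averaging_def SV_def
  by (auto simp: einterval_iff monotone_on_def zero_ereal_def intro: less_trans)

section \<open>Norm bounds\<close>

text \<open>Half the gap turns each step \<open>k\<close> into a factor \<open>1 / (2 * C)\<close>,
  which cancels one \<open>C\<close> and leaves \<open>1 / 2\<close>.\<close>

lemma powr_geometric:
  assumes C: "0 < C" and b: "b powr (\<theta> / 2) = 2 * C" "0 < b"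
  shows "C ^ Suc k * b powr (y - real k * (\<theta> / 2)) = C * b powr y * (1 / 2) ^ k"
proof -
  have "b powr (real k * (\<theta> / 2)) = (b powr (\<theta> / 2)) powr real k"
    by (simp add: powr_powr mult.commute)
  also have "\<dots> = 2 ^ k * C ^ k"
    using C by (simp add: b powr_realpow power_mult_distrib)
  finally show ?thesis
    using C by (simp add: powr_diff power_divide)
qed

context ri_qnorm
begin

lemma B_norm_avg_left_le:
  assumes SV: "SV L d" and W: "0 < W" and p: "0 < p" "1 / p < \<alpha>"
    and c: "0 < c" "\<And>a. 0 < a \<Longrightarrow> a < 1 \<Longrightarrow> dil_norm L \<rho> a \<le> ennreal (c * a powr (- 1 / p))"
  obtains K where "0 < K" "\<And>h. rcdecr L h \<Longrightarrow>
    B_norm L \<rho> (averaging.avg W \<alpha> d (\<lambda>_. 0) ereal h) \<le> ennreal K * B_norm L \<rho> h"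
proof -
  interpret averaging L W \<alpha> d "\<lambda>_. 0" ereal
    by (rule averaging_left[OF W SV])
  define \<theta> where "\<theta> = \<alpha> - 1 / p"
  have th: "0 < \<theta>" using p by (simp add: \<theta>_def)
  then have th4: "0 < \<theta> / 4" by simp
  define b where "b = (2 * Crho) powr (2 / \<theta>)"
  have b: "1 < b" "b powr (\<theta> / 2) = 2 * Crho"
    using Crho(1) th by (simp_all add: b_def powr_powr)
  define \<beta> where "\<beta> = \<alpha> - \<theta> / 2"
  have beta: "0 < \<beta>"
  proof -
    have "\<beta> = 1 / p + \<theta> / 2" by (simp add: \<beta>_def \<theta>_def field_simps)
    then show ?thesis using p th by (simp add: add_pos_pos)
  qed
  \<comment> \<open>For \<open>v\<close> in the block
    \<open>b powr k \<le> t / v < b powr (k + 1)\<close>, the left end \<open>a k * t\<close> bounds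
    \<open>h v\<close> by antitonicity, while the right end bounds
    \<open>(v / t) powr \<beta>\<close> by \<open>w k\<close>. The shift by one costs the factor
    \<open>b powr (1 / p)\<close> in \<open>M\<close>; it also keeps \<open>a 0\<close> strictly
    below 1, the range covered by \<open>c\<close>.\<close>
  define a where "a k = b powr (- (real k + 1))" for k :: nat
  define w where "w k = b powr (- (real k * \<beta>))" for k :: nat
  define \<delta> where "\<delta> k = c * a k powr (- 1 / p)" for k :: nat
  define S where "S h t = (\<Sum>k. ennreal (w k) * edil L (a k) h t)" for h t
  have a: "0 < a k" "a k < 1" for k
    using b powr_less_mono[of "- (real k + 1)" 0 b] by (simp_all add: a_def)
  define M where "M = c * Crho * b powr (1 / p)"
  have M: "0 < M"
    using c Crho(1) b by (simp add: M_def)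
  have Mk: "Crho ^ Suc k * (w k * \<delta> k) = M * (1 / 2) ^ k" for k
  proof -
    have e: "a k powr (- 1 / p) = b powr ((real k + 1) * (1 / p))"
      unfolding a_def powr_powr by (rule arg_cong[where f = "\<lambda>x. b powr x"]) (simp add: divide_inverse algebra_simps)
    have "w k * \<delta> k = c * b powr (- (real k * \<beta>) + (real k + 1) * (1 / p))"
      by (simp only: w_def \<delta>_def e mult.left_commute powr_add)
    also have "- (real k * \<beta>) + (real k + 1) * (1 / p) = 1 / p - real k * (\<theta> / 2)"
      by (simp add: \<beta>_def \<theta>_def algebra_simps diff_divide_distrib add_divide_distrib)
    finally have "w k * \<delta> k = c * b powr (1 / p - real k * (\<theta> / 2))" .
    then show ?thesis
      using powr_geometric[OF _ b(2), of k "1 / p"] Crho(1) b(1) by (simp add: M_def)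
  qed
  have Sle: "B_norm L \<rho> (S h) \<le> ennreal (2 * M) * B_norm L \<rho> h"
    if "rcdecr L h" "B_norm L \<rho> h < \<infinity>" for h
    unfolding S_def[abs_def]
    by (rule B_norm_dilation_series[OF that, where \<delta> = \<delta>])
      (use a b c M Mk in \<open>auto simp: w_def \<delta>_def\<close>)
  obtain K where K: "0 < K"
    "\<forall>s\<in>einterval 0 L. \<forall>t\<in>einterval 0 L. s \<le> t \<longrightarrow>
      d s \<le> K * (t / s) powr (\<theta> / 4) * d t \<and> d t \<le> K * (t / s) powr (\<theta> / 4) * d s"
    using SV_growth[OF SV th4] by (elim exE conjE)
  obtain M' where M': "0 < M'" "\<And>t. 0 < t \<Longrightarrow>
    Lnorm W 0 (ereal t) (\<lambda>v. ennreal ((v / t) powr (\<theta> / 4) * v powr (- recip W))) \<le> ennreal M'"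
    using Lnorm_powr_left[OF W th4] by blast
  have pt: "avg h t \<le> ennreal (K * M') * S h t" if h: "rcdecr L h" and t: "t \<in> einterval 0 L" for h t
  proof (rule avg_le[OF t K(1) M'(1)])
    have t0: "0 < t" using t by (simp add: einterval_iff zero_ereal_def)
    show "Lnorm W 0 (ereal t) (\<lambda>v. ennreal ((v / t) powr (\<theta> / 4) * v powr (- recip W))) \<le> ennreal M'"
      by (rule M'(2)[OF t0])
    \<comment> \<open>Here \<open>- (\<theta> / 4)\<close> allows for growth of \<open>d\<close>
      towards 0, and \<open>\<theta> / 4\<close> makes the remaining power integrable there.\<close>
    show "\<alpha> + - (\<theta> / 4) = \<theta> / 4 + \<beta>"
      by (simp add: \<beta>_def)
    show "antimono_on (einterval 0 L) h"
      using h by (simp add: rcdecr_def)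
    fix v assume "v \<in> einterval 0 (ereal t)"
    then have v: "0 < v" "v < t"
      by (simp_all add: einterval_iff zero_ereal_def)
    then have vI: "v \<in> einterval 0 L"
      using mult_in_einterval0[OF t] by simp
    have "(t / v) powr (\<theta> / 4) = (v / t) powr (- (\<theta> / 4))"
      using v t0 by (simp add: powr_minus powr_divide)
    then show "d v \<le> K * (v / t) powr (- (\<theta> / 4)) * d t"
      using conjunct1[OF K(2)[rule_format, OF vI t less_imp_le[OF v(2)]]] by (simp only:)
    obtain k :: nat where k: "b powr real k \<le> t / v" "t / v < b powr (real k + 1)"
      using geometric_bracket[OF b(1), of "t / v"] v by auto
    have "v / t \<le> b powr (- real k)"
      using k(1) v t0 b(1) by (simp add: powr_minus field_simps)
    then have "(v / t) powr \<beta> \<le> (b powr (- real k)) powr \<beta>"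
      using beta v t0 by (intro powr_mono2) auto
    then have wk: "(v / t) powr \<beta> \<le> w k"
      by (simp add: w_def powr_powr)
    have "t < b powr (real k + 1) * v"
      using k(2) v by (simp add: pos_divide_less_eq)
    moreover have "a k = 1 / b powr (real k + 1)"
      by (simp only: a_def powr_minus_divide)
    ultimately have "a k * t \<le> v"
      using b(1) by (simp add: pos_divide_le_eq mult.commute)
    moreover have "0 < a k * t"
      using a t0 by simp
    ultimately have "a k * t \<in> einterval 0 L" "h v \<le> h (a k * t)"
      using mult_in_einterval0[OF vI] rcdecr_mono[OF h _ vI] by auto
    then have "ennreal (w k) * h v \<le> ennreal (w k) * edil L (a k) h t"
      by (intro mult_left_mono) (simp_all add: edil_def)
    also have "\<dots> \<le> S h t"
      unfolding S_def using sum_le_suminf[of "\<lambda>k. ennreal (w k) * edil L (a k) h t" "{k}"] by simp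
    finally show "\<exists>w. (v / t) powr \<beta> \<le> w \<and> ennreal w * h v \<le> S h t"
      using wk by blast
  qed
  show ?thesis
  proof (rule that)
    show "0 < K * M' * (2 * M)"
      using K(1) M' M by simp
    fix h assume h: "rcdecr L h"
    show "B_norm L \<rho> (avg h) \<le> ennreal (K * M' * (2 * M)) * B_norm L \<rho> h"
    proof (cases "B_norm L \<rho> h < \<infinity>")
      case True
      have Sm: "S h \<in> borel_measurable (leb L)"
        unfolding S_def[abs_def] using rcdecr_measurable[OF rcdecr_edil[OF h a(1)]] by measurable
      have "B_norm L \<rho> (avg h) \<le> B_norm L \<rho> (\<lambda>t. ennreal (K * M') * S h t)"
        using Sm h by (intro B_norm_mono avg_measurable AE_leb_I pt) (simp_all add: rcdecr_def)
      also have "\<dots> = ennreal (K * M') * B_norm L \<rho> (S h)"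
        using K(1) M' by (intro B_norm_cmult Sm) simp
      also have "\<dots> \<le> ennreal (K * M') * (ennreal (2 * M) * B_norm L \<rho> h)"
        by (intro mult_left_mono Sle h True) simp
      also have "\<dots> = ennreal (K * M' * (2 * M)) * B_norm L \<rho> h"
        using K(1) M' M by (simp add: ennreal_mult mult.assoc)
      finally show ?thesis .
    next
      case False
      then show ?thesis
        using K(1) M' M by (simp add: less_top[symmetric] ennreal_mult_top)
    qed
  qed
qed

lemma B_norm_avg_right_le:
  assumes SV: "SV L d" and W: "0 < W" and q: "0 < q" "0 \<le> \<alpha>" "\<alpha> < 1 / q"
    and c: "0 < c" "\<And>a. 1 \<le> a \<Longrightarrow> dil_norm L \<rho> a \<le> ennreal (c * a powr (- 1 / q))"
  obtains K where "0 < K" "\<And>h. rcdecr L h \<Longrightarrow>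
    B_norm L \<rho> (averaging.avg W \<alpha> d ereal (\<lambda>_. L) h) \<le> ennreal K * B_norm L \<rho> h"
proof -
  interpret averaging L W \<alpha> d ereal "\<lambda>_. L"
    by (rule averaging_right[OF W SV])
  define \<theta> where "\<theta> = 1 / q - \<alpha>"
  have th: "0 < \<theta>" using q by (simp add: \<theta>_def)
  then have th4: "0 < \<theta> / 4" by simp
  define b where "b = (2 * Crho) powr (2 / \<theta>)"
  have b: "1 < b" "b powr (\<theta> / 2) = 2 * Crho"
    using Crho(1) th by (simp_all add: b_def powr_powr)
  define \<beta> where "\<beta> = \<alpha> + \<theta> / 2"
  have beta: "0 < \<beta>"
    using q th by (simp add: \<beta>_def)
  \<comment> \<open>Again the left end of a block controls \<open>h\<close> and the right end the
    power, but now the shift by one falls on \<open>w\<close> and costs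
    \<open>b powr \<beta>\<close>. The first factor \<open>a 0\<close> is 1, which the hypothesis on
    dilations with factor at least 1 includes.\<close>
  define a where "a k = b powr real k" for k :: nat
  define w where "w k = b powr ((real k + 1) * \<beta>)" for k :: nat
  define \<delta> where "\<delta> k = c * a k powr (- 1 / q)" for k :: nat
  define S where "S h t = (\<Sum>k. ennreal (w k) * edil L (a k) h t)" for h t
  have a: "0 < a k" "1 \<le> a k" for k
    using b by (simp_all add: a_def ge_one_powr_ge_zero)
  define M where "M = c * Crho * b powr \<beta>"
  have M: "0 < M"
    using c Crho(1) b by (simp add: M_def)
  have Mk: "Crho ^ Suc k * (w k * \<delta> k) = M * (1 / 2) ^ k" for k
  proof -
    have e: "a k powr (- 1 / q) = b powr (- (real k * (1 / q)))"
      unfolding a_def powr_powr by (rule arg_cong[where f = "\<lambda>x. b powr x"]) (simp add: divide_inverse algebra_simps)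
    have "w k * \<delta> k = c * b powr ((real k + 1) * \<beta> + - (real k * (1 / q)))"
      by (simp only: w_def \<delta>_def e mult.left_commute powr_add)
    also have "(real k + 1) * \<beta> + - (real k * (1 / q)) = \<beta> - real k * (\<theta> / 2)"
      by (simp add: \<beta>_def \<theta>_def algebra_simps diff_divide_distrib add_divide_distrib)
    finally have "w k * \<delta> k = c * b powr (\<beta> - real k * (\<theta> / 2))" .
    then show ?thesis
      using powr_geometric[OF _ b(2), of k \<beta>] Crho(1) b(1) by (simp add: M_def)
  qed
  have Sle: "B_norm L \<rho> (S h) \<le> ennreal (2 * M) * B_norm L \<rho> h"
    if "rcdecr L h" "B_norm L \<rho> h < \<infinity>" for h
    unfolding S_def[abs_def]
    by (rule B_norm_dilation_series[OF that, where \<delta> = \<delta>])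
      (use a b c M Mk in \<open>auto simp: w_def \<delta>_def\<close>)
  obtain K where K: "0 < K"
    "\<forall>s\<in>einterval 0 L. \<forall>t\<in>einterval 0 L. s \<le> t \<longrightarrow>
      d s \<le> K * (t / s) powr (\<theta> / 4) * d t \<and> d t \<le> K * (t / s) powr (\<theta> / 4) * d s"
    using SV_growth[OF SV th4] by (elim exE conjE)
  obtain M' where M': "0 < M'" "\<And>t. 0 < t \<Longrightarrow>
    Lnorm W (ereal t) L (\<lambda>v. ennreal ((v / t) powr (- (\<theta> / 4)) * v powr (- recip W))) \<le> ennreal M'"
    using Lnorm_powr_right[OF W th4] by blast
  have pt: "avg h t \<le> ennreal (K * M') * S h t" if h: "rcdecr L h" and t: "t \<in> einterval 0 L" for h t
  proof (rule avg_le[OF t K(1) M'(1)])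
    have t0: "0 < t" using t by (simp add: einterval_iff zero_ereal_def)
    show "Lnorm W (ereal t) L (\<lambda>v. ennreal ((v / t) powr (- (\<theta> / 4)) * v powr (- recip W))) \<le> ennreal M'"
      by (rule M'(2)[OF t0])
    \<comment> \<open>Signs are opposite to those for \<open>(0,t)\<close>: \<open>d\<close> may
      grow to the right of \<open>t\<close>, and the norm requires decay at infinity.\<close>
    show "\<alpha> + \<theta> / 4 = - (\<theta> / 4) + \<beta>"
      by (simp add: \<beta>_def)
    show "antimono_on (einterval 0 L) h"
      using h by (simp add: rcdecr_def)
    fix v assume v': "v \<in> einterval (ereal t) L"
    then have v: "t < v"
      by (simp add: einterval_iff)
    have vI: "v \<in> einterval 0 L"
      using v' dom_subset[OF t] by blast
    show "d v \<le> K * (v / t) powr (\<theta> / 4) * d t"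
      using K(2) vI t v by simp
    obtain k :: nat where k: "b powr real k \<le> v / t" "v / t < b powr (real k + 1)"
      using geometric_bracket[OF b(1), of "v / t"] v t0 by auto
    have "(v / t) powr \<beta> \<le> (b powr (real k + 1)) powr \<beta>"
      using beta v t0 k(2) by (intro powr_mono2) auto
    then have wk: "(v / t) powr \<beta> \<le> w k"
      by (simp add: w_def powr_powr)
    have "a k * t \<le> v"
      using k(1) t0 by (simp add: a_def field_simps)
    moreover have "0 < a k * t"
      using a t0 by simp
    ultimately have "a k * t \<in> einterval 0 L" "h v \<le> h (a k * t)"
      using mult_in_einterval0[OF vI] rcdecr_mono[OF h _ vI] by auto
    then have "ennreal (w k) * h v \<le> ennreal (w k) * edil L (a k) h t"
      by (intro mult_left_mono) (simp_all add: edil_def)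
    also have "\<dots> \<le> S h t"
      unfolding S_def using sum_le_suminf[of "\<lambda>k. ennreal (w k) * edil L (a k) h t" "{k}"] by simp
    finally show "\<exists>w. (v / t) powr \<beta> \<le> w \<and> ennreal w * h v \<le> S h t"
      using wk by blast
  qed
  show ?thesis
  proof (rule that)
    show "0 < K * M' * (2 * M)"
      using K(1) M' M by simp
    fix h assume h: "rcdecr L h"
    show "B_norm L \<rho> (avg h) \<le> ennreal (K * M' * (2 * M)) * B_norm L \<rho> h"
    proof (cases "B_norm L \<rho> h < \<infinity>")
      case True
      have Sm: "S h \<in> borel_measurable (leb L)"
        unfolding S_def[abs_def] using rcdecr_measurable[OF rcdecr_edil[OF h a(1)]] by measurable
      have "B_norm L \<rho> (avg h) \<le> B_norm L \<rho> (\<lambda>t. ennreal (K * M') * S h t)"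
        using Sm h by (intro B_norm_mono avg_measurable AE_leb_I pt) (simp_all add: rcdecr_def)
      also have "\<dots> = ennreal (K * M') * B_norm L \<rho> (S h)"
        using K(1) M' by (intro B_norm_cmult Sm) simp
      also have "\<dots> \<le> ennreal (K * M') * (ennreal (2 * M) * B_norm L \<rho> h)"
        by (intro mult_left_mono Sle h True) simp
      also have "\<dots> = ennreal (K * M' * (2 * M)) * B_norm L \<rho> h"
        using K(1) M' M by (simp add: ennreal_mult mult.assoc)
      finally show ?thesis .
    next
      case False
      then show ?thesis
        using K(1) M' M by (simp add: less_top[symmetric] ennreal_mult_top)
    qed
  qed
qed

section \<open>Lower bounds for the averages in norm\<close>

lemma B_norm_le_avg_left:
  assumes SV: "SV L d" and W: "0 < W" and \<alpha>: "0 \<le> \<alpha>"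
  obtains K where "0 < K" "\<And>h. rcdecr L h \<Longrightarrow>
    B_norm L \<rho> h \<le> ennreal K * B_norm L \<rho> (averaging.avg W \<alpha> d (\<lambda>_. 0) ereal h)"
proof -
  interpret averaging L W \<alpha> d "\<lambda>_. 0" ereal
    by (rule averaging_left[OF W SV])
  obtain K where K: "0 < K"
    "\<forall>s\<in>einterval 0 L. \<forall>t\<in>einterval 0 L. s \<le> t \<longrightarrow>
      d s \<le> K * (t / s) powr 1 * d t \<and> d t \<le> K * (t / s) powr 1 * d s"
    using SV_growth[OF SV zero_less_one] by (elim exE conjE)
  \<comment> \<open>On \<open>(t/2,t)\<close> the ratio \<open>t / v\<close> is below 2, which gives
    \<open>2 * K\<close> from growth with exponent 1, and \<open>v > t / 2\<close> gives
    \<open>(1 / 2) powr \<alpha>\<close>. The power of 14 comes from \<open>le_avg\<close>.\<close>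
  define K' where "K' = 2 * K / (1 / 2) powr \<alpha> * 14 powr recip W"
  have r: "0 \<le> recip W"
    using recip_pos[OF W] by (cases "W = \<infinity>") (auto simp: recip_def)
  have pt: "h t \<le> ennreal K' * avg h t" if h: "rcdecr L h" and t: "t \<in> einterval 0 L" for h t
    unfolding K'_def
  proof (rule le_avg[OF t _ _ r, where p = "t / 2" and q = t])
    have t0: "0 < t" using t by (simp add: einterval_iff zero_ereal_def)
    show "0 \<le> t / 2" "t / 2 + t / 7 \<le> t" "t \<le> 2 * t" "{t / 2<..<t} \<subseteq> einterval 0 (ereal t)"
      using t0 by (auto simp: einterval_iff zero_ereal_def)
    show "antimono_on (einterval 0 L) h"
      using h by (simp add: rcdecr_def)
    fix v assume v: "t / 2 < v" "v < t"
    then have v0: "0 < v" using t0 by simp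
    have vI: "v \<in> einterval 0 L"
      using mult_in_einterval0[OF t v0] v by simp
    have "d t \<le> K * (t / v) powr 1 * d v"
      by (rule conjunct2[OF K(2)[rule_format, OF vI t less_imp_le[OF v(2)]]])
    also have "\<dots> \<le> K * 2 * d v"
      using v v0 t0 K(1) d_pos[OF vI] by (intro mult_right_mono mult_left_mono) (auto simp: field_simps)
    finally have "d t \<le> 2 * K * d v" by simp
    moreover have "(1 / 2) powr \<alpha> * t powr \<alpha> \<le> v powr \<alpha>"
      using powr_mono2[OF \<alpha>, of "t / 2" v] v t0 by (simp add: powr_divide)
    ultimately show "h t \<le> h v \<and> d t \<le> 2 * K * d v \<and> (1 / 2) powr \<alpha> * t powr \<alpha> \<le> v powr \<alpha>"
      using rcdecr_mono[OF h vI t] v by simp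
  qed (use K in auto)
  have K': "0 < K'"
    using K by (simp add: K'_def)
  show ?thesis
  proof (rule that[OF K'])
    fix h assume h: "rcdecr L h"
    have am: "avg h \<in> borel_measurable (leb L)"
      using h by (intro avg_measurable) (simp add: rcdecr_def)
    have "B_norm L \<rho> h \<le> B_norm L \<rho> (\<lambda>t. ennreal K' * avg h t)"
      using am by (intro B_norm_mono[OF _ rcdecr_measurable[OF h]] AE_leb_I pt h) auto
    also have "\<dots> = ennreal K' * B_norm L \<rho> (avg h)"
      using K' by (intro B_norm_cmult am) simp
    finally show "B_norm L \<rho> h \<le> ennreal K' * B_norm L \<rho> (avg h)" .
  qed
qed

lemma B_norm_le_avg_right:
  assumes SV: "SV L d" and W: "0 < W" and \<alpha>: "0 \<le> \<alpha>"
  obtains K where "0 < K" "\<And>h. rcdecr L h \<Longrightarrow>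
    B_norm L \<rho> h \<le> ennreal K * B_norm L \<rho> (averaging.avg W \<alpha> d ereal (\<lambda>_. L) h)"
proof -
  interpret averaging L W \<alpha> d ereal "\<lambda>_. L"
    by (rule averaging_right[OF W SV])
  obtain K where K: "0 < K"
    "\<forall>s\<in>einterval 0 L. \<forall>t\<in>einterval 0 L. s \<le> t \<longrightarrow>
      d s \<le> K * (t / s) powr 1 * d t \<and> d t \<le> K * (t / s) powr 1 * d s"
    using SV_growth[OF SV zero_less_one] by (elim exE conjE)
  \<comment> \<open>To the right of \<open>t\<close> no power is lost, so the
    \<open>\<kappa>\<close> of \<open>le_avg\<close> is 1; it is kept as a divisor to match that
    lemma.\<close>
  define K' where "K' = 2 * K / 1 * 14 powr recip W"
  have r: "0 \<le> recip W"
    using recip_pos[OF W] by (cases "W = \<infinity>") (auto simp: recip_def)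
  have pt: "edil L (8 / 7) h t \<le> ennreal K' * avg h t" if h: "rcdecr L h" and t: "t \<in> einterval 0 L" for h t
  proof (cases "8 / 7 * t \<in> einterval 0 L")
    case True
    have t0: "0 < t" using t by (simp add: einterval_iff zero_ereal_def)
    \<comment> \<open>The interval \<open>(t, 8t/7)\<close> has exactly the length
      \<open>t / 7\<close> that \<open>le_avg\<close> asks for, and \<open>h\<close> is at least
      \<open>h(8t/7)\<close> on it. Beyond the right end of the domain the dilation is 0, so the
      other case is trivial.\<close>
    have "h (8 / 7 * t) \<le> ennreal K' * avg h t"
      unfolding K'_def
    proof (rule le_avg[OF t _ _ r, where p = t and q = "8 / 7 * t"])
      show "{t<..<8 / 7 * t} \<subseteq> einterval (ereal t) L"
        using mult_in_einterval0[OF True] t0 by (auto simp: einterval_iff)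
      show "0 \<le> t" "t + t / 7 \<le> 8 / 7 * t" "8 / 7 * t \<le> 2 * t"
        using t0 by auto
      show "antimono_on (einterval 0 L) h"
        using h by (simp add: rcdecr_def)
      fix v assume v: "t < v" "v < 8 / 7 * t"
      then have v0: "0 < v" using t0 by simp
      have vI: "v \<in> einterval 0 L"
        using mult_in_einterval0[OF True v0] v by simp
      have "d t \<le> K * (v / t) powr 1 * d v"
        by (rule conjunct1[OF K(2)[rule_format, OF t vI less_imp_le[OF v(1)]]])
      also have "\<dots> \<le> K * 2 * d v"
        using v v0 t0 K(1) d_pos[OF vI] by (intro mult_right_mono mult_left_mono) (auto simp: field_simps)
      finally have "d t \<le> 2 * K * d v" by simp
      moreover have "1 * t powr \<alpha> \<le> v powr \<alpha>"
        using powr_mono2[OF \<alpha>, of t v] v t0 by simp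
      ultimately show "h (8 / 7 * t) \<le> h v \<and> d t \<le> 2 * K * d v \<and> 1 * t powr \<alpha> \<le> v powr \<alpha>"
        using rcdecr_mono[OF h vI True] v by simp
    qed (use K in auto)
    then show ?thesis
      using True by (simp add: edil_def)
  qed (simp add: edil_def)
  have K': "0 < K'"
    using K by (simp add: K'_def)
  obtain K2 where K2: "0 < K2"
    "\<And>h. rcdecr L h \<Longrightarrow> B_norm L \<rho> h \<le> ennreal K2 * B_norm L \<rho> (edil L (8 / 7) h)"
    using B_norm_le_edil by metis
  show ?thesis
  proof (rule that)
    show "0 < K2 * K'"
      using K2(1) K' by simp
    fix h assume h: "rcdecr L h"
    have am: "avg h \<in> borel_measurable (leb L)"
      using h by (intro avg_measurable) (simp add: rcdecr_def)
    have "B_norm L \<rho> h \<le> ennreal K2 * B_norm L \<rho> (edil L (8 / 7) h)"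
      by (rule K2(2)[OF h])
    also have "\<dots> \<le> ennreal K2 * B_norm L \<rho> (\<lambda>t. ennreal K' * avg h t)"
      using am by (intro mult_left_mono B_norm_mono[OF _ rcdecr_measurable[OF rcdecr_edil[OF h]]] AE_leb_I pt h) auto
    also have "\<dots> = ennreal K2 * (ennreal K' * B_norm L \<rho> (avg h))"
      using K' by (subst B_norm_cmult[OF am]) simp_all
    also have "\<dots> = ennreal (K2 * K') * B_norm L \<rho> (avg h)"
      using K' K2(1) by (simp add: ennreal_mult mult.assoc)
    finally show "B_norm L \<rho> h \<le> ennreal (K2 * K') * B_norm L \<rho> (avg h)" .
  qed
qed

section \<open>Both averages as instances of \<open>ri_operator\<close>, and the theorem\<close>

lemma ri_operator_avg:
  assumes "averaging L W d a b"
    and K1: "0 < K1" "\<And>h. rcdecr L h \<Longrightarrow> B_norm L \<rho> h \<le> ennreal K1 * B_norm L \<rho> (averaging.avg W \<alpha> d a b h)"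
    and K2: "0 < K2" "\<And>h. rcdecr L h \<Longrightarrow> B_norm L \<rho> (averaging.avg W \<alpha> d a b h) \<le> ennreal K2 * B_norm L \<rho> h"
  shows "ri_operator L \<rho> (averaging.avg W \<alpha> d a b) (max K1 K2)"
proof -
  interpret averaging L W \<alpha> d a b by fact
  show ?thesis
  proof
    fix f assume "f \<in> Mplus L"
    then have r: "rcdecr L (rearr L f)"
      by (intro rcdecr_rearr MplusD)
    have "ennreal K1 * y \<le> ennreal (max K1 K2) * y" "ennreal K2 * y \<le> ennreal (max K1 K2) * y" for y
      by (intro mult_right_mono ennreal_leI; simp)+
    from order_trans[OF K1(2)[OF r] this(1)] order_trans[OF K2(2)[OF r] this(2)]
    show "EN f \<le> ennreal (max K1 K2) * B_norm L \<rho> (avg (rearr L f))"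
      "B_norm L \<rho> (avg (rearr L f)) \<le> ennreal (max K1 K2) * EN f" .
  qed (use K1(1) avg_measurable avg_mono avg_cmult avg_SUP in auto)
qed

end

theorem theorem21:
  fixes L U V W :: ereal
    and \<rho> :: "(real \<Rightarrow> ennreal) \<Rightarrow> ennreal"
    and d :: "real \<Rightarrow> real"
  assumes "L = 1 \<or> L = \<infinity>"
    and "function_quasinorm L \<rho>"
    and "quasinorm_on L (E_space L \<rho>) (E_norm L \<rho>)"
    and "SV L d"
    and "0 < U" and "U < \<infinity>" and "0 < V" and "V \<le> \<infinity>" and "0 < W" and "W \<le> \<infinity>"
  shows "(U < lower_Boyd L \<rho> \<longrightarrow>
            equivalent_on (Mfun L) (E_norm L \<rho>) (\<lambda>f. B_norm L \<rho> (H_left L U W d (modulus f))) \<and>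
            quasinorm_on L (E_space L \<rho>) (\<lambda>f. B_norm L \<rho> (H_left L U W d (modulus f))) \<and>
            ri_qbfs L (E_space L \<rho>) (\<lambda>f. B_norm L \<rho> (H_left L U W d f))) \<and>
         (upper_Boyd L \<rho> < V \<longrightarrow>
            equivalent_on (Mfun L) (E_norm L \<rho>) (\<lambda>f. B_norm L \<rho> (H_right L V W d (modulus f))) \<and>
            quasinorm_on L (E_space L \<rho>) (\<lambda>f. B_norm L \<rho> (H_right L V W d (modulus f))) \<and>
            ri_qbfs L (E_space L \<rho>) (\<lambda>f. B_norm L \<rho> (H_right L V W d f)))"
proof (intro conjI[of "_ \<longrightarrow> _"] impI)
  interpret ri_qnorm L \<rho>
    by unfold_locales fact+
  note SV = \<open>SV L d\<close> and W = \<open>0 < W\<close>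
  {
    assume "U < lower_Boyd L \<rho>"
    \<comment> \<open>Strict inequality with the supremum yields an admissible exponent
      \<open>p\<close> above \<open>U\<close>; the gap \<open>recip U - 1 / p\<close> is what the
      upper bound spends.\<close>
    then obtain p c where p: "0 < p" "U < ereal p" and c: "0 < c"
      "\<And>a. 0 < a \<Longrightarrow> a < 1 \<Longrightarrow> dil_norm L \<rho> a \<le> ennreal (c * a powr (- 1 / p))"
      unfolding lower_Boyd_def less_Sup_iff by blast
    obtain u where u: "U = ereal u" "0 < u"
      using \<open>0 < U\<close> \<open>U < \<infinity>\<close> by (cases U) (auto simp: zero_ereal_def)
    have \<alpha>: "0 \<le> recip U" "1 / p < recip U"
      using u p by (simp_all add: recip_def one_ereal_def divide_strict_left_mono)
    interpret averaging L W "recip U" d "\<lambda>_. 0" ereal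
      by (rule averaging_left[OF W SV])
    have H: "H_left L U W d f = avg (rearr L f)" for f
      by (simp add: fun_eq_iff H_left_def avg_def)
    obtain K1 where K1: "0 < K1" "\<And>h. rcdecr L h \<Longrightarrow> B_norm L \<rho> h \<le> ennreal K1 * B_norm L \<rho> (avg h)"
      using B_norm_le_avg_left[OF SV W \<alpha>(1)] by blast
    obtain K2 where K2: "0 < K2" "\<And>h. rcdecr L h \<Longrightarrow> B_norm L \<rho> (avg h) \<le> ennreal K2 * B_norm L \<rho> h"
      using B_norm_avg_left_le[OF SV W p(1) \<alpha>(2) c] by blast
    interpret ri_operator L \<rho> avg "max K1 K2"
      by (rule ri_operator_avg[OF averaging_left[OF W SV] K1 K2])
    show "equivalent_on (Mfun L) (E_norm L \<rho>) (\<lambda>f. B_norm L \<rho> (H_left L U W d (modulus f))) \<and>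
        quasinorm_on L (E_space L \<rho>) (\<lambda>f. B_norm L \<rho> (H_left L U W d (modulus f))) \<and>
        ri_qbfs L (E_space L \<rho>) (\<lambda>f. B_norm L \<rho> (H_left L U W d f))"
      unfolding H by (intro conjI equivalent_on_N quasinorm_on_N ri_qbfs_N)
  next
    assume "upper_Boyd L \<rho> < V"
    then obtain q c where q: "0 < q" "ereal q < V" and c: "0 < c"
      "\<And>a. 1 \<le> a \<Longrightarrow> dil_norm L \<rho> a \<le> ennreal (c * a powr (- 1 / q))"
      unfolding upper_Boyd_def Inf_less_iff by blast
    \<comment> \<open>For \<open>V = \<infinity>\<close> the exponent is 0, still strictly below
      \<open>1 / q\<close>.\<close>
    have \<alpha>: "0 \<le> recip V" "recip V < 1 / q"
      using \<open>0 < V\<close> q by (cases V; simp add: recip_def one_ereal_def zero_ereal_def divide_strict_left_mono)+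
    interpret averaging L W "recip V" d ereal "\<lambda>_. L"
      by (rule averaging_right[OF W SV])
    have H: "H_right L V W d f = avg (rearr L f)" for f
      by (simp add: fun_eq_iff H_right_def avg_def)
    obtain K1 where K1: "0 < K1" "\<And>h. rcdecr L h \<Longrightarrow> B_norm L \<rho> h \<le> ennreal K1 * B_norm L \<rho> (avg h)"
      using B_norm_le_avg_right[OF SV W \<alpha>(1)] by blast
    obtain K2 where K2: "0 < K2" "\<And>h. rcdecr L h \<Longrightarrow> B_norm L \<rho> (avg h) \<le> ennreal K2 * B_norm L \<rho> h"
      using B_norm_avg_right_le[OF SV W q(1) \<alpha> c] by blast
    interpret ri_operator L \<rho> avg "max K1 K2"
      by (rule ri_operator_avg[OF averaging_right[OF W SV] K1 K2])
    show "equivalent_on (Mfun L) (E_norm L \<rho>) (\<lambda>f. B_norm L \<rho> (H_right L V W d (modulus f))) \<and>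
        quasinorm_on L (E_space L \<rho>) (\<lambda>f. B_norm L \<rho> (H_right L V W d (modulus f))) \<and>
        ri_qbfs L (E_space L \<rho>) (\<lambda>f. B_norm L \<rho> (H_right L V W d f))"
      unfolding H by (intro conjI equivalent_on_N quasinorm_on_N ri_qbfs_N)
  }
qed

end
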